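(* Let $K$ be an infinite field and let $G$ be a connected graph on $n \ge 2$ vertices, with binomial edge ideal $J_G \subset S = K[x_1,\ldots,x_n,y_1,\ldots,y_n]$. Then $$n-1 \le \ell(J_G) \le 2n-3 .$$
   Context: All graphs are finite and simple; a graph on $n$ vertices has vertex set $V=[n]=\{1,\ldots,n\}$ and edge set $E$. The binomial edge ideal of $G=(V,E)$ is $J_G=(x_iy_j-x_jy_i \mid \{i,j\}\in E)\subset S=K[x_1,\ldots,x_n,y_1,\ldots,y_n]$. For a homogeneous ideal $I$ in a polynomial ring $A$ over $K$ with homogeneous maximal ideal $\mathfrak m$ (generated by all the variables of $A$), the Rees algebra is $A[It]=\bigoplus_{k\ge 0} I^k t^k$, the special fiber ring is $F(I)=A[It]/\mathfrak m A[It]$, and the analytic spread is $\ell(I)=\dim F(I)$ (Krull dimension). *)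

theory Defs
  imports
    "HOL-Algebra.Ideal_Product"
    "HOL-Algebra.QuotRing"
    "HOL-Algebra.Algebraic_Closure_Type"
    "HOL-Library.Extended_Nat"
    "HOL-Library.Poly_Mapping"
    "HOL-Computational_Algebra.Polynomial"
begin

text \<open>The supremum of the lengths \<open>d\<close> of chains \<open>P\<^sub>0 \<subset> \<dots> \<subset> P\<^sub>d\<close> of prime ideals. The zero ring, which
  has no prime ideals, gets the value \<open>0\<close>.\<close>

definition krull_dim :: "('a, 'b) ring_scheme \<Rightarrow> enat" where
  "krull_dim R = Sup {enat d | d. \<exists>P :: nat \<Rightarrow> 'a set.
     (\<forall>i\<le>d. primeideal (P i) R) \<and> (\<forall>i<d. P i \<subset> P (Suc i))}"

primrec ideal_power :: "('a, 'b) ring_scheme \<Rightarrow> 'a set \<Rightarrow> nat \<Rightarrow> 'a set" where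
  "ideal_power R I 0 = carrier R"
| "ideal_power R I (Suc k) = ideal_prod R I (ideal_power R I k)"

text \<open>A monomial is a finitely supported exponent vector, a polynomial is a finitely supported
  function from monomials to coefficients.\<close>

type_synonym ('x, 'k) mpoly = "('x \<Rightarrow>\<^sub>0 nat) \<Rightarrow>\<^sub>0 'k"

definition mvar :: "'x \<Rightarrow> ('x, 'k::comm_ring_1) mpoly" where
  "mvar v = Poly_Mapping.single (Poly_Mapping.single v 1) 1"

text \<open>The polynomial ring \<open>K[Z]\<close> over a set \<open>Z\<close> of variables: all polynomials that involve no variable
  outside \<open>Z\<close>.\<close>

definition mpoly_ring :: "'x set \<Rightarrow> ('x, 'k::comm_ring_1) mpoly ring" where
  "mpoly_ring Z = ring_of_type_algebra
     \<lparr>carrier := {p. \<forall>m \<in> Poly_Mapping.keys p. Poly_Mapping.keys m \<subseteq> Z}\<rparr>"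

definition max_homogeneous_ideal :: "'x set \<Rightarrow> ('x, 'k::comm_ring_1) mpoly set" where
  "max_homogeneous_ideal Z = genideal (mpoly_ring Z) (mvar ` Z)"

text \<open>Here \<open>A\<close> is meant to be a ring whose operations are those of the type \<open>'a\<close>, such as
  \<^term>\<open>mpoly_ring Z\<close>. The Rees algebra \<open>A[It]\<close> is the subring of \<open>A[t]\<close> consisting of the polynomials
  in \<open>t\<close> whose coefficient of \<open>t\<^sup>k\<close> lies in \<open>I\<^sup>k\<close>, for every \<open>k\<close>.\<close>

definition rees_algebra :: "'a::comm_ring_1 ring \<Rightarrow> 'a set \<Rightarrow> 'a poly ring" where
  "rees_algebra A I = ring_of_type_algebra
     \<lparr>carrier := {p. \<forall>k. poly.coeff p k \<in> ideal_power A I k}\<rparr>"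

text \<open>The constant polynomials \<open>[:a:]\<close> form the copy of \<open>A\<close> inside \<open>A[It]\<close>; so the ideal generated by
  the \<open>[:a:]\<close> with \<open>a \<in> M\<close> is the extended ideal \<open>M A[It]\<close>.\<close>

definition special_fiber ::
  "'a::comm_ring_1 ring \<Rightarrow> 'a set \<Rightarrow> 'a set \<Rightarrow> 'a poly set ring" where
  "special_fiber A M I =
     rees_algebra A I Quot genideal (rees_algebra A I) ((\<lambda>a. [:a:]) ` M)"

definition analytic_spread :: "'x set \<Rightarrow> ('x, 'k::comm_ring_1) mpoly set \<Rightarrow> enat" where
  "analytic_spread Z I =
     krull_dim (special_fiber (mpoly_ring Z) (max_homogeneous_ideal Z) I)"

definition simple_graph :: "'v set \<Rightarrow> 'v set set \<Rightarrow> bool" where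
  "simple_graph V E \<longleftrightarrow> finite V \<and> (\<forall>e\<in>E. e \<subseteq> V \<and> card e = 2)"

definition connected_graph :: "'v set \<Rightarrow> 'v set set \<Rightarrow> bool" where
  "connected_graph V E \<longleftrightarrow> simple_graph V E \<and> V \<noteq> {} \<and>
     (\<forall>u\<in>V. \<forall>v\<in>V. (u, v) \<in> {(i, j). {i, j} \<in> E}\<^sup>*)"

datatype edge_var = Xv nat | Yv nat

definition edge_vars :: "nat \<Rightarrow> edge_var set" where
  "edge_vars n = Xv ` {1..n} \<union> Yv ` {1..n}"

text \<open>Each edge contributes its generator with both signs, once for each of its two orientations.\<close>

definition binomial_edge_ideal ::
  "nat \<Rightarrow> nat set set \<Rightarrow> (edge_var, 'k::comm_ring_1) mpoly set" where
  "binomial_edge_ideal n E = genideal (mpoly_ring (edge_vars n))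
     {mvar (Xv i) * mvar (Yv j) - mvar (Xv j) * mvar (Yv i) | i j. {i, j} \<in> E}"

end

theory Submission
  imports Defs
begin

text \<open>
  Let \<open>S = K[x\<^sub>1,\<dots>,y\<^sub>n]\<close>, let \<open>B = S[J\<^sub>G t] \<subseteq> S[t]\<close> be the Rees algebra and write \<open>[i j]\<close> for
  \<open>x\<^sub>i y\<^sub>j - x\<^sub>j y\<^sub>i\<close>. The primes of the special fiber ring are the primes of \<open>B\<close> that contain the ideal
  \<open>J = \<mm> B\<close>, where \<open>\<mm>\<close> is the ideal of all variables; so both bounds are statements about chains of such
  primes, and they can be proved without any general dimension theory.

  Upper bound. Given primes \<open>Q\<^sub>0 \<subset> \<dots> \<subset> Q\<^sub>d\<close> of \<open>B\<close> above \<open>J\<close>, elements \<open>a\<^sub>i \<in> Q\<^sub>i - Q\<^sub>i\<^sub>-\<^sub>1\<close> are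
  algebraically independent over \<open>K\<close> (\<open>chain_algebraically_independent\<close>). Modulo \<open>J\<close> every
  element of \<open>B\<close> is a polynomial in the elements \<open>[i j] t\<close>, so the \<open>a\<^sub>i\<close> may be chosen among these
  polynomials. The Pluecker relation \<open>[1 2] [i j] = [1 i] [2 j] - [1 j] [2 i]\<close> shows that, after multiplication
  by a power of \<open>D = [1 2] t\<close>, they become polynomials in the \<open>2n - 3\<close> elements \<open>[1 j] t\<close> and \<open>[2 j] t\<close>. The
  \<open>N\<^sup>d\<close> monomials in the \<open>a\<^sub>i\<close> with exponents below \<open>N\<close>, multiplied by a common power of \<open>D\<close>, then lie in
  a \<open>K\<close>-space of dimension at most \<open>(C N + 1)\<close> to the power \<open>2n - 3\<close>, with \<open>C\<close> independent of \<open>N\<close>. Letting \<open>N\<close> grow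
  gives \<open>d \<le> 2n - 3\<close> (\<open>krull_dim_Quot_le_card\<close>, \<open>analytic_spread_le_card\<close>).

  Lower bound. As \<open>J\<^sub>G\<close> is generated by quadrics, the coefficient of \<open>t\<^sup>k\<close> in an element of \<open>B\<close> has no terms of
  degree below \<open>2k\<close>, and taking its component of degree \<open>2k\<close> is a ring homomorphism \<open>B \<rightarrow> S[t]\<close> that kills \<open>J\<close>.
  Composing it with the homomorphism that sets to zero all variables at vertices outside a set \<open>C\<close> gives
  a prime of \<open>B\<close> above \<open>J\<close>, namely the kernel. Since \<open>G\<close> is connected, its vertices can be removed one by one
  so that each removed vertex is adjacent to a remaining one; the binomial of the edge between them,
  times \<open>t\<close>, lies in the next kernel but not in the previous one. This is a chain of \<open>n\<close> primes
  (\<open>analytic_spread_ge\<close>).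
\<close>

section \<open>Subrings of a commutative ring and their ideals\<close>

abbreviation ring_on :: "'b::comm_ring_1 set \<Rightarrow> 'b ring" where
  "ring_on B \<equiv> ring_of_type_algebra\<lparr>carrier := B\<rparr>"

definition closed_subring :: "'b::comm_ring_1 set \<Rightarrow> bool" where
  "closed_subring B \<longleftrightarrow> 1 \<in> B \<and> (\<forall>x\<in>B. \<forall>y\<in>B. x - y \<in> B \<and> x * y \<in> B)"

lemma closed_subringD:
  assumes "closed_subring B"
  shows "0 \<in> B" "1 \<in> B" "x \<in> B \<Longrightarrow> - x \<in> B"
    "x \<in> B \<Longrightarrow> y \<in> B \<Longrightarrow> x + y \<in> B" "x \<in> B \<Longrightarrow> y \<in> B \<Longrightarrow> x - y \<in> B"
    "x \<in> B \<Longrightarrow> y \<in> B \<Longrightarrow> x * y \<in> B"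
proof -
  show zero: "0 \<in> B"
    using assms unfolding closed_subring_def by (metis diff_self)
  show uminus: "- x \<in> B" if "x \<in> B" for x
    using assms zero that unfolding closed_subring_def by (metis diff_0)
  show "x + y \<in> B" if "x \<in> B" "y \<in> B"
    using assms uminus[OF that(2)] that(1) unfolding closed_subring_def
    by (metis diff_minus_eq_add)
qed (use assms in \<open>auto simp: closed_subring_def\<close>)

lemma closed_subring_prod:
  assumes "closed_subring B" and "\<And>i. i \<in> I \<Longrightarrow> f i \<in> B"
  shows "prod f I \<in> B"
  using assms(2) by (induction I rule: infinite_finite_induct) (auto intro: closed_subringD[OF assms(1)])

lemma closed_subring_sum:
  assumes "closed_subring B" and "\<And>i. i \<in> I \<Longrightarrow> f i \<in> B"
  shows "sum f I \<in> B"
  using assms(2) by (induction I rule: infinite_finite_induct) (auto intro: closed_subringD[OF assms(1)])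

lemma closed_subring_power:
  assumes "closed_subring B" and "x \<in> B"
  shows "x ^ k \<in> B"
  using assms(2) by (induction k) (auto intro: closed_subringD[OF assms(1)])

lemma ring_on_simps [simp]:
  "monoid.mult (ring_on B) = (*)" "monoid.one (ring_on B) = 1"
  "ring.zero (ring_on B) = 0" "ring.add (ring_on B) = (+)"
  by (simp_all add: ring_of_type_algebra_def fun_eq_iff)

lemma cring_ring_on:
  assumes "closed_subring B"
  shows "cring (ring_on B)"
proof (intro cringI abelian_groupI comm_monoidI)
  fix x assume "x \<in> carrier (ring_on B)"
  then show "\<exists>y\<in>carrier (ring_on B). y \<oplus>\<^bsub>ring_on B\<^esub> x = \<zero>\<^bsub>ring_on B\<^esub>"
    using closed_subringD(3)[OF assms] by (intro bexI[of _ "- x"]) auto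
qed (auto simp: algebra_simps closed_subringD[OF assms])

lemma ideal_ring_on_iff:
  assumes "closed_subring B"
  shows "ideal J (ring_on B) \<longleftrightarrow>
    J \<subseteq> B \<and> 0 \<in> J \<and> (\<forall>x\<in>J. \<forall>y\<in>J. x + y \<in> J) \<and> (\<forall>b\<in>B. \<forall>x\<in>J. b * x \<in> J)"
    (is "_ \<longleftrightarrow> ?rhs")
proof
  assume J: "ideal J (ring_on B)"
  then interpret ideal J "ring_on B" .
  show ?rhs
    using a_subset additive_subgroup.zero_closed[OF is_additive_subgroup] I_l_closed
      additive_subgroup.a_closed[OF is_additive_subgroup] by auto
next
  interpret cring "ring_on B"
    by (rule cring_ring_on[OF assms])
  assume rhs: ?rhs
  have right: "x * b \<in> J" if "x \<in> J" "b \<in> B" for x b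
    using rhs that by (metis mult.commute)
  have neg: "- x \<in> J" if "x \<in> J" for x
    using rhs that closed_subringD(2,3)[OF assms] by (metis mult_minus1)
  show "ideal J (ring_on B)"
  proof (rule idealI[OF ring_axioms])
    show "subgroup J (add_monoid (ring_on B))"
    proof (rule add.subgroupI)
      fix a assume a: "a \<in> J"
      then have "\<ominus>\<^bsub>ring_on B\<^esub> a = - a"
        using rhs by (intro minus_equality) (auto intro: closed_subringD(3)[OF assms])
      then show "\<ominus>\<^bsub>ring_on B\<^esub> a \<in> J"
        using neg[OF a] by simp
    qed (use rhs in auto)
  qed (use rhs right in auto)
qed

lemma primeideal_ring_on_iff:
  assumes "closed_subring B"
  shows "primeideal Q (ring_on B) \<longleftrightarrow>
    ideal Q (ring_on B) \<and> 1 \<notin> Q \<and> (\<forall>a\<in>B. \<forall>b\<in>B. a * b \<in> Q \<longrightarrow> a \<in> Q \<or> b \<in> Q)"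
    (is "_ \<longleftrightarrow> ?rhs")
proof
  assume "primeideal Q (ring_on B)"
  then interpret primeideal Q "ring_on B" .
  show ?rhs
    using is_ideal one_imp_carrier I_notcarr I_prime by auto
next
  assume ?rhs
  then show "primeideal Q (ring_on B)"
    using closed_subringD(2)[OF assms]
    by (intro primeidealI cring_ring_on[OF assms]) auto
qed

text \<open>The homomorphism need only respect the operations on \<open>B\<close>: the map used for the lower bound is
  multiplicative on the Rees algebra only.\<close>

lemma primeideal_kernel:
  fixes h :: "'b::comm_ring_1 \<Rightarrow> 'c::idom"
  assumes B: "closed_subring B"
    and add: "\<And>x y. x \<in> B \<Longrightarrow> y \<in> B \<Longrightarrow> h (x + y) = h x + h y"
    and mult: "\<And>x y. x \<in> B \<Longrightarrow> y \<in> B \<Longrightarrow> h (x * y) = h x * h y"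
    and one: "h 1 = 1"
  shows "primeideal {b \<in> B. h b = 0} (ring_on B)"
proof -
  have "h 0 = 0"
    using add[of 0 0] closed_subringD(1)[OF B] by (metis add.right_neutral add_left_cancel)
  then show ?thesis
    unfolding primeideal_ring_on_iff[OF B] ideal_ring_on_iff[OF B]
    by (auto simp: add mult one closed_subringD[OF B])
qed

section \<open>Krull dimension of a quotient\<close>

lemma primeideal_Quot_image:
  assumes "cring R" "ideal J R" "primeideal Q R" "J \<subseteq> Q"
  shows "primeideal ((+>\<^bsub>R\<^esub>) J ` Q) (R Quot J)"
proof -
  interpret cring R by fact
  interpret J: ideal J R by fact
  interpret Q: primeideal Q R by fact
  have mem: "J +>\<^bsub>R\<^esub> a \<in> (+>\<^bsub>R\<^esub>) J ` Q \<longleftrightarrow> a \<in> Q" if carr: "a \<in> carrier R" for a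
  proof
    assume "J +>\<^bsub>R\<^esub> a \<in> (+>\<^bsub>R\<^esub>) J ` Q"
    then obtain q where q: "q \<in> Q" and eq: "J +>\<^bsub>R\<^esub> a = J +>\<^bsub>R\<^esub> q"
      by (rule imageE)
    have "a \<in> J +>\<^bsub>R\<^esub> q"
      using J.a_rcos_self[OF carr] by (simp only: eq)
    then obtain j where "j \<in> J" "a = j \<oplus>\<^bsub>R\<^esub> q"
      by (auto simp: a_r_coset_def')
    then show "a \<in> Q"
      using q assms(4) Q.a_closed[of j q] by auto
  qed (rule imageI)
  have carr: "carrier (R Quot J) = (+>\<^bsub>R\<^esub>) J ` carrier R"
    unfolding FactRing_def A_RCOSETS_def' by auto
  show ?thesis
  proof (rule primeidealI)
    show "ideal ((+>\<^bsub>R\<^esub>) J ` Q) (R Quot J)"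
      by (rule ring_ideal_imp_quot_ideal[OF assms(2) Q.is_ideal])
    show "cring (R Quot J)"
      by (rule J.quotient_is_cring[OF assms(1)])
    show "carrier (R Quot J) \<noteq> (+>\<^bsub>R\<^esub>) J ` Q"
      using mem[OF one_closed] Q.one_imp_carrier Q.I_notcarr imageI[OF one_closed, of "(+>\<^bsub>R\<^esub>) J"]
      unfolding carr by auto
    fix A B assume "A \<in> carrier (R Quot J)" "B \<in> carrier (R Quot J)"
      and AB: "A \<otimes>\<^bsub>R Quot J\<^esub> B \<in> (+>\<^bsub>R\<^esub>) J ` Q"
    then obtain a b where ab: "a \<in> carrier R" "b \<in> carrier R" "A = J +>\<^bsub>R\<^esub> a" "B = J +>\<^bsub>R\<^esub> b"
      unfolding carr by blast
    then have "J +>\<^bsub>R\<^esub> (a \<otimes>\<^bsub>R\<^esub> b) \<in> (+>\<^bsub>R\<^esub>) J ` Q"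
      using AB by (simp add: FactRing_def J.rcoset_mult_add)
    then have "a \<otimes>\<^bsub>R\<^esub> b \<in> Q"
      using mem ab by simp
    then show "A \<in> (+>\<^bsub>R\<^esub>) J ` Q \<or> B \<in> (+>\<^bsub>R\<^esub>) J ` Q"
      using Q.I_prime[OF ab(1,2)] ab(3,4) by blast
  qed
qed

lemma krull_dim_Quot_ge:
  assumes "cring R" "ideal J R"
    and "\<And>i. i \<le> d \<Longrightarrow> primeideal (Q i) R \<and> J \<subseteq> Q i"
    and "\<And>i. i < d \<Longrightarrow> Q i \<subset> Q (Suc i)"
  shows "enat d \<le> krull_dim (R Quot J)"
proof -
  interpret cring R by fact
  have inj: "inj_on ((`) ((+>\<^bsub>R\<^esub>) J)) {Q. ideal Q R \<and> J \<subseteq> Q}"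
    using quot_ideal_correspondence[OF assms(2)] by (rule bij_betw_imp_inj_on)
  have "primeideal ((+>\<^bsub>R\<^esub>) J ` Q i) (R Quot J)" if "i \<le> d" for i
    using primeideal_Quot_image assms that by blast
  moreover have "(+>\<^bsub>R\<^esub>) J ` Q i \<subset> (+>\<^bsub>R\<^esub>) J ` Q (Suc i)" if "i < d" for i
  proof -
    have "ideal (Q k) R \<and> J \<subseteq> Q k" if "k \<in> {i, Suc i}" for k
      using assms(3)[of k] that \<open>i < d\<close> by (auto intro: primeideal.axioms)
    then have "(+>\<^bsub>R\<^esub>) J ` Q i \<noteq> (+>\<^bsub>R\<^esub>) J ` Q (Suc i)"
      using inj_onD[OF inj, of "Q i" "Q (Suc i)"] assms(4)[OF that] by auto
    then show ?thesis
      using assms(4)[OF that] by blast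
  qed
  ultimately show ?thesis
    unfolding krull_dim_def
    by (intro Sup_upper CollectI exI[of _ d] conjI refl exI[of _ "\<lambda>i. (+>\<^bsub>R\<^esub>) J ` Q i"]) auto
qed

text \<open>Preimages of primes under the canonical projection are primes above \<open>J\<close>, and strict inclusions stay
  strict because the projection is surjective.\<close>

lemma krull_dim_Quot_le:
  assumes "cring R" "ideal J R"
    and bound: "\<And>d Q. (\<And>i. i \<le> d \<Longrightarrow> primeideal (Q i) R \<and> J \<subseteq> Q i) \<Longrightarrow>
       (\<And>i. i < d \<Longrightarrow> Q i \<subset> Q (Suc i)) \<Longrightarrow> d \<le> m"
  shows "krull_dim (R Quot J) \<le> enat m"
proof -
  interpret cring R by fact
  interpret J: ideal J R by fact
  interpret hom: ring_hom_ring R "R Quot J" "(+>\<^bsub>R\<^esub>) J"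
    by (rule J.rcos_ring_hom_ring)
  have carr: "carrier (R Quot J) = (+>\<^bsub>R\<^esub>) J ` carrier R"
    unfolding FactRing_def A_RCOSETS_def' by auto
  have "d \<le> m"
    if P: "\<forall>i\<le>d. primeideal (P i) (R Quot J)" and inc: "\<forall>i<d. P i \<subset> P (Suc i)" for d P
  proof (rule bound)
    let ?Q = "\<lambda>i. {r \<in> carrier R. J +>\<^bsub>R\<^esub> r \<in> P i}"
    fix i assume i: "i \<le> d"
    interpret P: primeideal "P i" "R Quot J"
      using P i by blast
    have "J \<in> P i"
      using P.zero_closed unfolding FactRing_def by simp
    then have "J \<subseteq> ?Q i"
      using J.a_subset J.a_rcos_const by auto
    moreover have "primeideal (?Q i) R"
      using hom.primeideal_vimage[OF assms(1)] P i by blast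
    ultimately show "primeideal (?Q i) R \<and> J \<subseteq> ?Q i" by blast
  next
    fix i assume i: "i < d"
    let ?Q = "\<lambda>i. {r \<in> carrier R. J +>\<^bsub>R\<^esub> r \<in> P i}"
    obtain C where C: "C \<in> P (Suc i)" "C \<notin> P i"
      using inc i by blast
    interpret P: primeideal "P (Suc i)" "R Quot J"
      using P i by auto
    have "C \<in> (+>\<^bsub>R\<^esub>) J ` carrier R"
      using C(1) P.a_subset unfolding carr by (rule set_mp[rotated])
    then obtain x where "x \<in> carrier R" "C = J +>\<^bsub>R\<^esub> x"
      by (rule imageE)
    then show "?Q i \<subset> ?Q (Suc i)"
      using C inc i by blast
  qed
  then show ?thesis
    unfolding krull_dim_def by (intro Sup_least) auto
qed

section \<open>Counting monomials in finitely many elements\<close>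

text \<open>A \<open>K\<close>-algebra structure on a domain, given by the embedding of the scalars. It turns the domain into a
  vector space over \<open>K\<close>, so that dimensions can be compared.\<close>

locale scalar_embedding =
  fixes \<kappa> :: "'k::field \<Rightarrow> 'b::idom"
  assumes kappa_one: "\<kappa> 1 = 1"
    and kappa_add: "\<kappa> (a + b) = \<kappa> a + \<kappa> b"
    and kappa_mult: "\<kappa> (a * b) = \<kappa> a * \<kappa> b"
begin

sublocale vs: vector_space "\<lambda>c x. \<kappa> c * x"
  by unfold_locales (simp_all add: kappa_one kappa_add kappa_mult algebra_simps)

lemma kappa_zero: "\<kappa> 0 = 0"
  using vs.scale_zero_left[of 1] by simp

lemma kappa_minus: "\<kappa> (- a) = - \<kappa> a"
  using vs.scale_minus_left[of a 1] by simp

text \<open>Independence of the family, rather than of its image as a set, also gives injectivity; so the index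
  set itself can be counted.\<close>

lemma card_le_of_independent_family:
  assumes "finite I" "finite T" "f ` I \<subseteq> vs.span T"
    and indep: "\<And>c. (\<Sum>i\<in>I. \<kappa> (c i) * f i) = 0 \<Longrightarrow> \<forall>i\<in>I. c i = 0"
  shows "card I \<le> card T"
proof -
  have inj: "inj_on f I"
  proof (rule inj_onI, rule ccontr)
    fix i j assume ij: "i \<in> I" "j \<in> I" "f i = f j" "i \<noteq> j"
    define c where "c k = (if k = i then 1 else if k = j then -1 else 0 :: 'k)" for k
    have "(\<Sum>k\<in>I. \<kappa> (c k) * f k) = (\<Sum>k\<in>{i, j}. \<kappa> (c k) * f k)"
      by (rule sum.mono_neutral_right) (use ij assms(1) in \<open>auto simp: c_def kappa_zero\<close>)
    also have "\<dots> = 0"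
      using ij by (simp add: c_def kappa_one kappa_minus)
    finally have "c i = 0"
      using indep ij(1) by blast
    then show False
      by (simp add: c_def)
  qed
  have "vs.independent (f ` I)"
  proof (rule vs.independent_if_scalars_zero)
    fix c x assume "(\<Sum>x\<in>f ` I. \<kappa> (c x) * x) = 0" "x \<in> f ` I"
    then show "c x = 0"
      using indep[of "c \<circ> f"] by (auto simp: sum.reindex[OF inj])
  qed (use assms(1) in auto)
  then have "card (f ` I) \<le> card T"
    using vs.independent_span_bound[OF assms(2)] assms(3) by blast
  then show ?thesis
    by (simp add: card_image[OF inj])
qed

text \<open>Exponents are bounded one by one and not by total degree. The number of such monomials is then bounded by a plain
  power of \<open>M + 1\<close>, and the exponent is still \<open>card U\<close>.\<close>

definition box_monomials :: "'b set \<Rightarrow> nat \<Rightarrow> 'b set" where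
  "box_monomials U M = (\<lambda>e. \<Prod>u\<in>U. u ^ e u) ` (U \<rightarrow>\<^sub>E {..M})"

definition box_span :: "'b set \<Rightarrow> nat \<Rightarrow> 'b set" where
  "box_span U M = vs.span (box_monomials U M)"

lemma
  assumes "finite U"
  shows finite_box_monomials: "finite (box_monomials U M)"
    and card_box_monomials_le: "card (box_monomials U M) \<le> (M + 1) ^ card U"
proof -
  have fin: "finite (U \<rightarrow>\<^sub>E {..M})"
    using assms by (intro finite_PiE) auto
  then show "finite (box_monomials U M)"
    unfolding box_monomials_def by simp
  have "card (box_monomials U M) \<le> card (U \<rightarrow>\<^sub>E {..M})"
    unfolding box_monomials_def by (rule card_image_le[OF fin])
  then show "card (box_monomials U M) \<le> (M + 1) ^ card U"
    using assms by (simp add: card_PiE)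
qed

lemma box_monomials_mono: "M \<le> M' \<Longrightarrow> box_monomials U M \<subseteq> box_monomials U M'"
  unfolding box_monomials_def by (intro image_mono PiE_mono) auto

lemma box_span_mono: "M \<le> M' \<Longrightarrow> box_span U M \<subseteq> box_span U M'"
  unfolding box_span_def by (intro vs.span_mono box_monomials_mono)

lemma box_monomials_mult:
  assumes "x \<in> box_monomials U M" "y \<in> box_monomials U M'"
  shows "x * y \<in> box_monomials U (M + M')"
proof -
  obtain e e' where e: "e \<in> U \<rightarrow>\<^sub>E {..M}" "e' \<in> U \<rightarrow>\<^sub>E {..M'}"
    "x = (\<Prod>u\<in>U. u ^ e u)" "y = (\<Prod>u\<in>U. u ^ e' u)"
    using assms unfolding box_monomials_def by blast
  define s where "s = (\<lambda>u\<in>U. e u + e' u)"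
  have "s \<in> U \<rightarrow>\<^sub>E {..M + M'}"
    using e(1,2) by (force simp: s_def PiE_iff intro: add_mono)
  moreover have "x * y = (\<Prod>u\<in>U. u ^ s u)"
    by (simp add: e(3,4) s_def power_add prod.distrib)
  ultimately show ?thesis
    unfolding box_monomials_def by blast
qed

lemma box_span_mult:
  assumes "x \<in> box_span U M" "y \<in> box_span U M'"
  shows "x * y \<in> box_span U (M + M')"
proof -
  have monomial_times: "m * y \<in> box_span U (M + M')" if m: "m \<in> box_monomials U M" for m
    using assms(2) unfolding box_span_def
  proof (induction rule: vs.span_induct_alt)
    case (step c x y)
    have "m * x \<in> vs.span (box_monomials U (M + M'))"
      using box_monomials_mult[OF m step(1)] by (rule vs.span_base)
    from vs.span_add[OF vs.span_scale[OF this, of c] step(2)] show ?case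
      by (simp add: algebra_simps)
  qed (simp add: vs.span_zero)
  show ?thesis
    using assms(1) unfolding box_span_def[of U M]
  proof (induction rule: vs.span_induct_alt)
    case (step c x z)
    from vs.span_add[OF vs.span_scale[OF monomial_times[OF step(1), unfolded box_span_def], of c]
        step(2)[unfolded box_span_def]]
    show ?case
      by (simp add: algebra_simps box_span_def)
  qed (simp add: vs.span_zero box_span_def)
qed

lemma one_in_box_monomials: "1 \<in> box_monomials U M"
  unfolding box_monomials_def by (rule image_eqI[of _ _ "\<lambda>u\<in>U. 0"]) auto

lemma kappa_in_box_span: "\<kappa> c \<in> box_span U M"
  using vs.span_scale[OF vs.span_base[OF one_in_box_monomials], of c U M]
  by (simp add: box_span_def)

lemma generator_in_box_span:
  assumes "finite U" "u \<in> U"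
  shows "u \<in> box_span U 1"
proof -
  have "(\<Prod>v\<in>U. v ^ (\<lambda>v\<in>U. of_bool (v = u)) v) = (\<Prod>v\<in>U. if v = u then u else 1)"
    by (intro prod.cong) auto
  also have "\<dots> = u"
    using assms by simp
  finally have "u \<in> box_monomials U 1"
    unfolding box_monomials_def by (intro image_eqI[of _ _ "\<lambda>v\<in>U. of_bool (v = u)"]) auto
  then show ?thesis
    unfolding box_span_def by (rule vs.span_base)
qed

lemma box_span_add: "x \<in> box_span U M \<Longrightarrow> y \<in> box_span U M \<Longrightarrow> x + y \<in> box_span U M"
  unfolding box_span_def by (rule vs.span_add)

lemma box_span_diff: "x \<in> box_span U M \<Longrightarrow> y \<in> box_span U M \<Longrightarrow> x - y \<in> box_span U M"
  unfolding box_span_def by (rule vs.span_diff)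

lemma box_span_power: "x \<in> box_span U M \<Longrightarrow> x ^ k \<in> box_span U (k * M)"
proof (induction k)
  case 0
  then show ?case
    using kappa_in_box_span[of 1] by (simp add: kappa_one)
next
  case (Suc k)
  then show ?case
    using box_span_mult[of x U M "x ^ k" "k * M"] by simp
qed

lemma box_span_prod:
  assumes "\<And>i. i \<in> I \<Longrightarrow> x i \<in> box_span U (M i)"
  shows "(\<Prod>i\<in>I. x i) \<in> box_span U (\<Sum>i\<in>I. M i)"
  using assms
proof (induction I rule: infinite_finite_induct)
  case (insert i I)
  then show ?case
    using box_span_mult[of "x i" U "M i" "prod x I" "sum M I"] by simp
qed (use kappa_in_box_span[of 1] in \<open>simp_all add: kappa_one\<close>)

text \<open>For \<open>D\<close> in the subalgebra \<open>K[U]\<close>, these are the elements that lie in the localization of \<open>K[U]\<close> at \<open>D\<close>.\<close>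

definition denominator_span :: "'b set \<Rightarrow> 'b \<Rightarrow> 'b set" where
  "denominator_span U D = {x. \<exists>c M. D ^ c * x \<in> box_span U M}"

lemma denominator_spanI: "D ^ c * x \<in> box_span U M \<Longrightarrow> x \<in> denominator_span U D"
  unfolding denominator_span_def by blast

lemma kappa_in_denominator_span: "\<kappa> c \<in> denominator_span U D"
  using denominator_spanI[of D 0] kappa_in_box_span by simp

lemma denominator_span_mult:
  assumes "x \<in> denominator_span U D" "y \<in> denominator_span U D"
  shows "x * y \<in> denominator_span U D"
proof -
  obtain c M c' M' where "D ^ c * x \<in> box_span U M" "D ^ c' * y \<in> box_span U M'"
    using assms unfolding denominator_span_def by blast
  from box_span_mult[OF this] have "D ^ (c + c') * (x * y) \<in> box_span U (M + M')"
    by (simp add: power_add algebra_simps)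
  then show ?thesis
    by (rule denominator_spanI)
qed

lemma denominator_span_add:
  assumes "D \<in> box_span U 1" "x \<in> denominator_span U D" "y \<in> denominator_span U D"
  shows "x + y \<in> denominator_span U D"
proof -
  obtain c M c' M' where c: "D ^ c * x \<in> box_span U M" "D ^ c' * y \<in> box_span U M'"
    using assms(2,3) unfolding denominator_span_def by blast
  define m where "m = c + c' + M + M'"
  have "D ^ c' * (D ^ c * x) \<in> box_span U m" "D ^ c * (D ^ c' * y) \<in> box_span U m"
    using box_span_mult[OF box_span_power[OF assms(1), of c'] c(1)]
      box_span_mult[OF box_span_power[OF assms(1), of c] c(2)]
      box_span_mono[of "c' * 1 + M" m U] box_span_mono[of "c * 1 + M'" m U]
    by (auto simp: m_def)
  from box_span_add[OF this] have "D ^ (c + c') * (x + y) \<in> box_span U m"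
    by (simp add: power_add algebra_simps)
  then show ?thesis
    by (rule denominator_spanI)
qed

end

text \<open>A polynomial of degree \<open>m\<close> in \<open>N\<close> cannot dominate \<open>N\<^sup>d\<close> when \<open>d > m\<close>.\<close>

lemma power_bound_imp_le:
  fixes C d m :: nat
  assumes "\<And>N. N > 0 \<Longrightarrow> N ^ d \<le> (C * N + 1) ^ m"
  shows "d \<le> m"
proof (rule ccontr)
  assume "\<not> d \<le> m"
  \<comment> \<open>From \<open>m < d\<close> the hypothesis would give \<open>N \<le> (C + 1)\<^sup>m\<close>, which this value violates.\<close>
  define N where "N = (C + 1) ^ m + 1"
  have "N ^ Suc m \<le> N ^ d"
    using \<open>\<not> d \<le> m\<close> by (intro power_increasing) (auto simp: N_def)
  also have "\<dots> \<le> (C * N + 1) ^ m"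
    by (rule assms) (simp add: N_def)
  also have "\<dots> \<le> ((C + 1) * N) ^ m"
    by (intro power_mono) (auto simp: N_def)
  also have "\<dots> = (C + 1) ^ m * N ^ m"
    by (rule power_mult_distrib)
  finally have "N \<le> (C + 1) ^ m"
    by (simp add: N_def)
  then show False
    by (simp add: N_def)
qed

section \<open>Chains of primes and algebraic independence\<close>

lemma sum_PiE_lessThan_Suc:
  fixes F :: "(nat \<Rightarrow> nat) \<Rightarrow> 'a::comm_monoid_add"
  shows "(\<Sum>e\<in>{..<Suc d} \<rightarrow>\<^sub>E {..<N}. F e) = (\<Sum>k<N. \<Sum>e\<in>{..<d} \<rightarrow>\<^sub>E {..<N}. F (e(d := k)))"
proof -
  have "(\<Sum>e\<in>{..<Suc d} \<rightarrow>\<^sub>E {..<N}. F e) =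
      (\<Sum>(k, e)\<in>{..<N} \<times> ({..<d} \<rightarrow>\<^sub>E {..<N}). F (e(d := k)))"
    unfolding lessThan_Suc PiE_insert_eq
    by (subst sum.reindex) (auto simp: case_prod_unfold intro!: inj_combinator[unfolded case_prod_unfold])
  then show ?thesis
    by (simp add: sum.cartesian_product)
qed

context scalar_embedding
begin

text \<open>The inductive step for algebraic independence along \<open>Q \<subset> Q'\<close>, with \<open>a\<close> in the difference. The sum is
  congruent to its constant term \<open>g 0\<close> modulo \<open>Q'\<close>, because \<open>a \<in> Q'\<close>; so \<open>g 0 \<in> Q'\<close> and hence \<open>g 0 = 0\<close>. The rest is
  a multiple of \<open>a \<notin> Q\<close>, and primality of \<open>Q\<close> permits division by \<open>a\<close>.\<close>

lemma power_sum_in_prime_imp_zero: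
  assumes B: "closed_subring B" and Q: "primeideal Q (ring_on B)" and Q': "ideal Q' (ring_on B)"
    and sub: "Q \<subseteq> Q'" and a: "a \<in> Q'" "a \<notin> Q"
    and g: "\<And>k. k < N \<Longrightarrow> g k \<in> B" "\<And>k. k < N \<Longrightarrow> g k \<in> Q' \<Longrightarrow> g k = 0"
    and sum: "(\<Sum>k<N. a ^ k * g k) \<in> Q"
    and "k < N"
  shows "g k = 0"
  using g sum \<open>k < N\<close>
proof (induction N arbitrary: g k)
  case (Suc N)
  note Q_props = Q[unfolded primeideal_ring_on_iff[OF B] ideal_ring_on_iff[OF B]]
  note Q'_props = Q'[unfolded ideal_ring_on_iff[OF B]]
  have aB: "a \<in> B"
    using a Q'_props by blast
  define s where "s = (\<Sum>k<N. a ^ k * g (Suc k))"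
  have sB: "s \<in> B"
    unfolding s_def using Suc.prems(1) closed_subringD(6)[OF B] closed_subring_power[OF B aB]
    by (intro closed_subring_sum[OF B]) auto
  have split: "(\<Sum>k<Suc N. a ^ k * g k) = g 0 + s * a"
    unfolding s_def by (subst sum.lessThan_Suc_shift) (simp add: sum_distrib_left mult_ac)
  have "g 0 + s * a \<in> Q'"
    using Suc.prems(3) sub unfolding split by blast
  moreover have "- s * a \<in> Q'"
    using Q'_props sB a closed_subringD(3)[OF B] by blast
  ultimately have "g 0 + s * a + - s * a \<in> Q'"
    using Q'_props by blast
  then have "g 0 \<in> Q'"
    by simp
  then have g0: "g 0 = 0"
    using Suc.prems(2)[of 0] by simp
  then have "s * a \<in> Q"
    using Suc.prems(3) unfolding split by simp
  then have "s \<in> Q"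
    using Q_props a(2) aB sB by blast
  then have "g (Suc k) = 0" if "k < N" for k
    using Suc.IH[of "\<lambda>k. g (Suc k)" k] Suc.prems(1,2) that unfolding s_def by auto
  then show ?case
    using g0 Suc.prems(4) by (cases k) auto
qed simp

text \<open>The chain is descending, so that the induction removes the last element \<open>a (d - 1)\<close>, which separates the
  smallest two primes: a relation in \<open>R d\<close> is a polynomial in this element whose coefficients are polynomials in the
  other ones, and by the induction hypothesis such a coefficient vanishes as soon as it lies in the next larger prime.\<close>

lemma chain_algebraically_independent:
  assumes B: "closed_subring B" and kappa: "range \<kappa> \<subseteq> B"
    and prime: "\<And>i. i \<le> d \<Longrightarrow> primeideal (R i) (ring_on B)"
    and dec: "\<And>i. i < d \<Longrightarrow> R (Suc i) \<subseteq> R i"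
    and a: "\<And>i. i < d \<Longrightarrow> a i \<in> R i - R (Suc i)"
    and "(\<Sum>e\<in>{..<d} \<rightarrow>\<^sub>E {..<N}. \<kappa> (c e) * (\<Prod>i<d. a i ^ e i)) \<in> R d"
    and "e \<in> {..<d} \<rightarrow>\<^sub>E {..<N}"
  shows "c e = 0"
  using assms(3-)
proof (induction d arbitrary: c e)
  case 0
  have e: "e = (\<lambda>_. undefined)"
    using "0.prems" by simp
  show ?case
  proof (rule ccontr)
    assume "c e \<noteq> 0"
    moreover have "\<kappa> (c e) \<in> R 0" "1 \<notin> R 0" "\<And>b x. b \<in> B \<Longrightarrow> x \<in> R 0 \<Longrightarrow> b * x \<in> R 0"
      using "0.prems"(1,4) unfolding primeideal_ring_on_iff[OF B] ideal_ring_on_iff[OF B] e by auto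
    ultimately have "\<kappa> (inverse (c e)) * \<kappa> (c e) \<in> R 0"
      using kappa by blast
    then show False
      using \<open>c e \<noteq> 0\<close> \<open>1 \<notin> R 0\<close> by (simp flip: kappa_mult add: kappa_one)
  qed
next
  case (Suc d)
  note props = Suc.prems(1)[unfolded primeideal_ring_on_iff[OF B] ideal_ring_on_iff[OF B]]
  define g where "g k = (\<Sum>e\<in>{..<d} \<rightarrow>\<^sub>E {..<N}. \<kappa> (c (e(d := k))) * (\<Prod>i<d. a i ^ e i))" for k
  have IH: "c (e(d := k)) = 0" if "g k \<in> R d" "e \<in> {..<d} \<rightarrow>\<^sub>E {..<N}" for k e
    using Suc.IH[of "\<lambda>e. c (e(d := k))" e] Suc.prems(1-3) that unfolding g_def by auto
  have aB: "a i \<in> B" if "i < Suc d" for i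
    using Suc.prems(3)[OF that] props[of i] that by auto
  have gB: "g k \<in> B" for k
    unfolding g_def using kappa
    by (intro closed_subring_sum[OF B] closed_subringD(6)[OF B] closed_subring_prod[OF B]
        closed_subring_power[OF B] aB) auto
  have "(\<Prod>i<Suc d. a i ^ (e(d := k)) i) = (\<Prod>i<d. a i ^ e i) * a d ^ k" for e k
    by (simp cong: prod.cong_simp)
  then have "(\<Sum>e\<in>{..<Suc d} \<rightarrow>\<^sub>E {..<N}. \<kappa> (c e) * (\<Prod>i<Suc d. a i ^ e i)) = (\<Sum>k<N. a d ^ k * g k)"
    unfolding sum_PiE_lessThan_Suc g_def by (simp add: sum_distrib_left mult_ac)
  then have sum: "(\<Sum>k<N. a d ^ k * g k) \<in> R (Suc d)"
    using Suc.prems(4) by simp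
  have g_zero: "g k = 0" if "g k \<in> R d" for k
    unfolding g_def using IH[OF that] by (intro sum.neutral) (auto simp: kappa_zero)
  have zero: "0 \<in> R d"
    using props[of d] by auto
  have e: "e d < N" "e(d := undefined) \<in> {..<d} \<rightarrow>\<^sub>E {..<N}"
    using Suc.prems(5) by (auto simp: PiE_iff extensional_def)
  have "g (e d) = 0"
    using power_sum_in_prime_imp_zero[OF B Suc.prems(1)[of "Suc d"] _ Suc.prems(2)[of d] _ _ gB g_zero sum e(1)]
      Suc.prems(1)[of d] Suc.prems(3)[of d] primeideal.axioms(1) by auto
  then show ?case
    using IH[of "e d" "e(d := undefined)"] zero e(2) by simp
qed

text \<open>If, modulo \<open>J\<close>, every element of \<open>B\<close> lies in the localization of \<open>K[U]\<close> at \<open>D\<close>, then the dimension of \<open>B/J\<close>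
  is at most the number of elements of \<open>U\<close>. The elements separating the primes of a chain are
  algebraically independent, and this stays true after replacing them by their representatives
  modulo \<open>J\<close>, as all the primes contain \<open>J\<close>. Counting monomials in them bounds the length of the chain.\<close>

theorem krull_dim_Quot_le_card:
  assumes B: "closed_subring B" and kappa: "range \<kappa> \<subseteq> B" and J: "ideal J (ring_on B)"
    and U: "finite U" and D: "D \<noteq> 0" "D \<in> box_span U 1"
    and approx: "\<And>b. b \<in> B \<Longrightarrow> \<exists>l\<in>B \<inter> denominator_span U D. b - l \<in> J"
  shows "krull_dim (ring_on B Quot J) \<le> enat (card U)"
proof (rule krull_dim_Quot_le[OF cring_ring_on[OF B] J])
  fix d Q
  assume Q: "\<And>i. i \<le> d \<Longrightarrow> primeideal (Q i) (ring_on B) \<and> J \<subseteq> Q i"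
    and inc: "\<And>i. i < d \<Longrightarrow> Q i \<subset> Q (Suc i)"
  define R where "R i = Q (d - i)" for i
  have prime: "primeideal (R i) (ring_on B)" and JR: "J \<subseteq> R i" for i
    using Q[of "d - i"] by (auto simp: R_def)
  note props = prime[unfolded primeideal_ring_on_iff[OF B] ideal_ring_on_iff[OF B]]
  have dec: "R (Suc i) \<subset> R i" if "i < d" for i
    using inc[of "d - Suc i"] that by (simp add: R_def Suc_diff_Suc)
  have "\<exists>l c M. l \<in> R i - R (Suc i) \<and> D ^ c * l \<in> box_span U M" if i: "i < d" for i
  proof -
    obtain b where b: "b \<in> R i" "b \<notin> R (Suc i)"
      using dec[OF i] by blast
    obtain l where l: "l \<in> B" "l \<in> denominator_span U D" "b - l \<in> J"
      using approx[of b] b(1) props[of i] by blast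
    have "- 1 * (b - l) \<in> J"
      using J[unfolded ideal_ring_on_iff[OF B]] l(3) closed_subringD(2,3)[OF B] by blast
    then have "b + (- 1 * (b - l)) \<in> R i"
      using props[of i] JR[of i] b(1) by blast
    moreover have "l \<notin> R (Suc i)"
      using props[of "Suc i"] JR[of "Suc i"] l(3) b(2) by (metis add.commute diff_add_cancel subsetD)
    ultimately show ?thesis
      using l(2) unfolding denominator_span_def by auto
  qed
  then obtain a c M where a: "\<And>i. i < d \<Longrightarrow> a i \<in> R i - R (Suc i)"
    and M: "\<And>i. i < d \<Longrightarrow> D ^ c i * a i \<in> box_span U (M i)"
    by metis
  show "d \<le> card U"
  proof (rule power_bound_imp_le)
    fix N :: nat
    \<comment> \<open>A denominator common to all monomials in the \<open>a i\<close> with exponents at most \<open>N\<close>.\<close>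
    define E where "E = (\<Prod>i<d. (D ^ c i) ^ N)"
    define f where "f e = E * (\<Prod>i<d. a i ^ e i)" for e
    define L where "L = (\<Sum>i<d. M i + c i) * N"
    have "f e \<in> box_span U L" if "e \<in> {..<d} \<rightarrow>\<^sub>E {..<N}" for e
    proof -
      have e: "e i \<le> N" if "i < d" for i
        using PiE_mem[OF \<open>e \<in> _\<close>, of i] that by simp
      have "f e = (\<Prod>i<d. (D ^ c i * a i) ^ e i * (D ^ c i) ^ (N - e i))"
        unfolding f_def E_def prod.distrib[symmetric]
      proof (intro prod.cong refl)
        fix i assume "i \<in> {..<d}"
        then have "(D ^ c i) ^ N = (D ^ c i) ^ e i * (D ^ c i) ^ (N - e i)"
          using e by (simp flip: power_add)
        then show "(D ^ c i) ^ N * a i ^ e i = (D ^ c i * a i) ^ e i * (D ^ c i) ^ (N - e i)"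
          by (simp add: power_mult_distrib)
      qed
      also have "\<dots> \<in> box_span U (\<Sum>i<d. e i * M i + (N - e i) * (c i * 1))"
        by (intro box_span_prod box_span_mult box_span_power D(2) M) simp
      also have "(\<Sum>i<d. e i * M i + (N - e i) * (c i * 1)) \<le> L"
        unfolding L_def sum_distrib_right add_mult_distrib using e
        by (intro sum_mono add_mono) (simp_all add: mult.commute)
      then have "box_span U (\<Sum>i<d. e i * M i + (N - e i) * (c i * 1)) \<subseteq> box_span U L"
        by (rule box_span_mono)
      finally show ?thesis .
    qed
    then have "f ` ({..<d} \<rightarrow>\<^sub>E {..<N}) \<subseteq> vs.span (box_monomials U L)"
      unfolding box_span_def by blast
    moreover have "\<forall>e\<in>{..<d} \<rightarrow>\<^sub>E {..<N}. k e = 0"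
      if "(\<Sum>e\<in>{..<d} \<rightarrow>\<^sub>E {..<N}. \<kappa> (k e) * f e) = 0" for k
    proof -
      have "E * (\<Sum>e\<in>{..<d} \<rightarrow>\<^sub>E {..<N}. \<kappa> (k e) * (\<Prod>i<d. a i ^ e i)) = 0"
        using that by (simp add: f_def sum_distrib_left mult_ac)
      moreover have "E \<noteq> 0"
        using D(1) by (simp add: E_def)
      ultimately have "(\<Sum>e\<in>{..<d} \<rightarrow>\<^sub>E {..<N}. \<kappa> (k e) * (\<Prod>i<d. a i ^ e i)) \<in> R d"
        using props[of d] by simp
      then show ?thesis
        using chain_algebraically_independent[OF B kappa, where d = d and R = R and a = a and N = N and c = k] prime a dec by blast
    qed
    ultimately have "card ({..<d} \<rightarrow>\<^sub>E {..<N}) \<le> card (box_monomials U L)"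
      by (intro card_le_of_independent_family finite_PiE finite_box_monomials U) auto
    also have "\<dots> \<le> (L + 1) ^ card U"
      by (rule card_box_monomials_le[OF U])
    finally show "N ^ d \<le> ((\<Sum>i<d. M i + c i) * N + 1) ^ card U"
      by (simp add: card_PiE L_def)
  qed
qed

end

section \<open>Multivariate polynomials\<close>

lemma poly_mapping_sum_single: "p = (\<Sum>m\<in>Poly_Mapping.keys p. Poly_Mapping.single m (Poly_Mapping.lookup p m))"
proof (rule poly_mapping_eqI)
  fix k
  show "Poly_Mapping.lookup p k =
      Poly_Mapping.lookup (\<Sum>m\<in>Poly_Mapping.keys p. Poly_Mapping.single m (Poly_Mapping.lookup p m)) k"
    by (simp add: lookup_sum lookup_single when_def sum.If_cases in_keys_iff)
qed

definition mconst :: "'k::comm_ring_1 \<Rightarrow> ('x, 'k) mpoly" where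
  "mconst c = Poly_Mapping.single 0 c"

lemma mconst_simps:
  "mconst 0 = 0" "mconst 1 = 1" "mconst (a + b) = mconst a + mconst b"
  "mconst (a * b) = mconst a * mconst b" "mconst (- a) = - mconst a"
  by (simp_all add: mconst_def single_add mult_single single_uminus)

definition mpolys_in :: "'x set \<Rightarrow> ('x, 'k::comm_ring_1) mpoly set" where
  "mpolys_in Z = {p. \<forall>m \<in> Poly_Mapping.keys p. Poly_Mapping.keys m \<subseteq> Z}"

lemma mpoly_ring_eq: "mpoly_ring Z = ring_on (mpolys_in Z)"
  by (simp add: mpoly_ring_def mpolys_in_def)

lemma mpolys_in_add: "p \<in> mpolys_in Z \<Longrightarrow> q \<in> mpolys_in Z \<Longrightarrow> p + q \<in> mpolys_in Z"
  using Poly_Mapping.keys_add[of p q] by (auto simp: mpolys_in_def)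

lemma keys_add_nat:
  fixes m m' :: "'x \<Rightarrow>\<^sub>0 nat"
  shows "Poly_Mapping.keys (m + m') = Poly_Mapping.keys m \<union> Poly_Mapping.keys m'"
  by (auto simp: in_keys_iff lookup_add)

lemma mpolys_in_mult:
  assumes "p \<in> mpolys_in Z" "q \<in> mpolys_in Z"
  shows "p * q \<in> mpolys_in Z"
  unfolding mpolys_in_def
proof safe
  fix m x
  assume "m \<in> Poly_Mapping.keys (p * q)" and x: "x \<in> Poly_Mapping.keys m"
  then obtain a b where "a \<in> Poly_Mapping.keys p" "b \<in> Poly_Mapping.keys q" "m = a + b"
    using Poly_Mapping.keys_mult[of p q] by blast
  then show "x \<in> Z"
    using assms x unfolding mpolys_in_def by (auto simp: keys_add_nat)
qed

lemma mconst_in_mpolys_in: "mconst c \<in> mpolys_in Z"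
  by (auto simp: mpolys_in_def mconst_def)

lemma mvar_in_mpolys_in: "z \<in> Z \<Longrightarrow> mvar z \<in> mpolys_in Z"
  by (auto simp: mpolys_in_def mvar_def)

lemma closed_subring_mpolys_in: "closed_subring (mpolys_in Z)"
proof -
  have "p - q \<in> mpolys_in Z" if "p \<in> mpolys_in Z" "q \<in> mpolys_in Z" for p q :: "('a, 'b) mpoly"
    using mpolys_in_add[OF that(1) mpolys_in_mult[OF mconst_in_mpolys_in[of "- 1"] that(2)]]
    by (simp add: mconst_simps)
  then show ?thesis
    using mpolys_in_mult mconst_in_mpolys_in[of 1]
    by (auto simp: closed_subring_def mconst_simps)
qed

text \<open>The polynomial ring is generated by constants and variables.\<close>

lemma mpolys_in_induct [consumes 1, case_names const var add mult]:
  fixes p :: "('x, 'k::comm_ring_1) mpoly"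
  assumes p: "p \<in> mpolys_in Z"
    and const: "\<And>c. P (mconst c)"
    and var: "\<And>z. z \<in> Z \<Longrightarrow> P (mvar z)"
    and add: "\<And>p q. P p \<Longrightarrow> P q \<Longrightarrow> P (p + q)"
    and mult: "\<And>p q. P p \<Longrightarrow> P q \<Longrightarrow> P (p * q)"
  shows "P p"
proof -
  have sum: "P (\<Sum>i\<in>I. f i)" if "\<And>i. i \<in> I \<Longrightarrow> P (f i)" for I and f :: "'i \<Rightarrow> ('x, 'k) mpoly"
    using that
  proof (induction I rule: infinite_finite_induct)
    case (insert i I)
    then show ?case
      by (simp add: add)
  qed (use const[of 0] in \<open>simp_all add: mconst_simps\<close>)
  have power: "P (Poly_Mapping.single (Poly_Mapping.single z k) 1)" if "z \<in> Z" for z k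
  proof (induction k)
    case 0
    then show ?case
      using const[of 1] by (simp add: mconst_simps)
  next
    case (Suc k)
    have "Poly_Mapping.single (Poly_Mapping.single z (Suc k)) (1 :: 'k) =
        mvar z * Poly_Mapping.single (Poly_Mapping.single z k) 1"
      by (simp add: mvar_def mult_single flip: single_add)
    then show ?case
      using mult[OF var[OF that] Suc] by simp
  qed
  have monomial_sum: "P (Poly_Mapping.single (\<Sum>z\<in>Y. Poly_Mapping.single z (e z)) 1)"
    if "Y \<subseteq> Z" for Y and e :: "'x \<Rightarrow> nat"
    using that
  proof (induction Y rule: infinite_finite_induct)
    case (insert z Y)
    have "Poly_Mapping.single (\<Sum>z\<in>insert z Y. Poly_Mapping.single z (e z)) (1 :: 'k) =
        Poly_Mapping.single (Poly_Mapping.single z (e z)) 1 *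
        Poly_Mapping.single (\<Sum>z\<in>Y. Poly_Mapping.single z (e z)) 1"
      using insert.hyps by (simp add: mult_single)
    then show ?case
      using mult[OF power insert.IH] insert.prems by simp
  qed (use const[of 1] in \<open>simp_all add: mconst_simps\<close>)
  have "P (Poly_Mapping.single m (Poly_Mapping.lookup p m))" if "m \<in> Poly_Mapping.keys p" for m
  proof -
    have "Poly_Mapping.keys m \<subseteq> Z"
      using p that unfolding mpolys_in_def by blast
    from mult[OF const monomial_sum[OF this, of "Poly_Mapping.lookup m"], of "Poly_Mapping.lookup p m"]
    show ?thesis
      using poly_mapping_sum_single[of m] by (simp add: mconst_def mult_single)
  qed
  then show "P p"
    by (subst poly_mapping_sum_single) (rule sum)
qed

section \<open>Rees algebras\<close>

lemma genideal_subset_ideal: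
  assumes "ideal I R" "G \<subseteq> I"
  shows "genideal R G \<subseteq> I"
  using assms unfolding genideal_def by blast

lemma coeff_mult_memI:
  assumes "\<And>i. i \<le> k \<Longrightarrow> coeff p i * coeff q (k - i) \<in> J"
    and "0 \<in> J" "\<And>x y. x \<in> J \<Longrightarrow> y \<in> J \<Longrightarrow> x + y \<in> J"
  shows "coeff (p * q) k \<in> J"
proof -
  have sum: "sum f I \<in> J" if "\<And>i. i \<in> I \<Longrightarrow> f i \<in> J" for I :: "nat set" and f
    using that by (induction I rule: infinite_finite_induct) (auto intro: assms(2,3))
  show ?thesis
    unfolding coeff_mult by (rule sum) (use assms(1) in auto)
qed

context
  fixes A :: "'a::comm_ring_1 set" and I :: "'a set"
  assumes A: "closed_subring A" and I: "ideal I (ring_on A)"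
begin

lemma ideal_ideal_power: "ideal (ideal_power (ring_on A) I k) (ring_on A)"
proof (induction k)
  case 0
  then show ?case
    using ring.oneideal[OF cring.axioms(1)[OF cring_ring_on[OF A]]] by simp
next
  case (Suc k)
  then show ?case
    using ring.ideal_prod_is_ideal[OF cring.axioms(1)[OF cring_ring_on[OF A]] I] by simp
qed

lemmas ideal_power_props = ideal_ideal_power[unfolded ideal_ring_on_iff[OF A]]

lemma ideal_power_mult:
  assumes "x \<in> ideal_power (ring_on A) I i" "y \<in> ideal_power (ring_on A) I j"
  shows "x * y \<in> ideal_power (ring_on A) I (i + j)"
  using assms
proof (induction i arbitrary: x)
  case 0
  then show ?case
    using ideal_power_props[of j] by simp
next
  case (Suc i)
  from Suc.prems(1) have "x \<in> ideal_prod (ring_on A) I (ideal_power (ring_on A) I i)"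
    by simp
  then show ?case
  proof (induction rule: ideal_prod.induct)
    case (prod a b)
    then have "a * (b * y) \<in> ideal_power (ring_on A) I (Suc (i + j))"
      using ideal_prod.prod[OF prod(1) Suc.IH[OF prod(2) Suc.prems(2)], of "ring_on A"] by simp
    then show ?case
      by (simp add: mult.assoc)
  next
    case (sum s t)
    then show ?case
      using ideal_power_props[of "Suc i + j"] by (simp add: distrib_right)
  qed
qed

lemma rees_algebra_eq:
  "rees_algebra (ring_on A) I = ring_on {p. \<forall>k. coeff p k \<in> ideal_power (ring_on A) I k}"
  by (simp add: rees_algebra_def)

lemma closed_subring_rees:
  "closed_subring {p. \<forall>k. coeff p k \<in> ideal_power (ring_on A) I k}"
  unfolding closed_subring_def
proof (intro conjI ballI CollectI allI; (elim CollectE)?)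
  show "coeff 1 k \<in> ideal_power (ring_on A) I k" for k
    using closed_subringD(2)[OF A] ideal_power_props[of k] by (cases k) auto
  fix p q k
  assume p: "\<forall>k. coeff p k \<in> ideal_power (ring_on A) I k"
    and q: "\<forall>k. coeff q k \<in> ideal_power (ring_on A) I k"
  have "- 1 * coeff q k \<in> ideal_power (ring_on A) I k"
    using closed_subringD(2,3)[OF A] ideal_power_props[of k] q by blast
  then show "coeff (p - q) k \<in> ideal_power (ring_on A) I k"
    using ideal_power_props[of k] p by (metis coeff_diff diff_conv_add_uminus mult_minus1)
  show "coeff (p * q) k \<in> ideal_power (ring_on A) I k"
  proof (rule coeff_mult_memI)
    fix i assume "i \<le> k"
    then show "coeff p i * coeff q (k - i) \<in> ideal_power (ring_on A) I k"
      using ideal_power_mult[of "coeff p i" i "coeff q (k - i)" "k - i"] p q by simp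
  qed (use ideal_power_props[of k] in auto)
qed

lemma monom_in_rees:
  assumes "x \<in> ideal_power (ring_on A) I k"
  shows "monom x k \<in> {p. \<forall>k. coeff p k \<in> ideal_power (ring_on A) I k}"
  using assms ideal_power_props by auto

lemma ideal_power_one: "x \<in> I \<Longrightarrow> x \<in> ideal_power (ring_on A) I 1"
  using ideal_prod.prod[of x I 1 A "ring_on A"] closed_subringD(2)[OF A] by simp

lemma constant_in_rees: "x \<in> A \<Longrightarrow> [:x:] \<in> {p. \<forall>k. coeff p k \<in> ideal_power (ring_on A) I k}"
  using monom_in_rees[of x 0] by (simp add: monom_0)

end

text \<open>If \<open>I\<close> is generated by \<open>G\<close>, then \<open>A[It]\<close> is generated as a ring by \<open>A\<close> and the elements \<open>g t\<close> with \<open>g \<in> G\<close>.\<close>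

lemma rees_induct [consumes 3, case_names const gen add mult]:
  fixes A :: "'a::comm_ring_1 set"
  assumes A: "closed_subring A" and G: "G \<subseteq> A"
    and p: "\<And>k. coeff p k \<in> ideal_power (ring_on A) (genideal (ring_on A) G) k"
    and const: "\<And>a. a \<in> A \<Longrightarrow> P [:a:]"
    and gen: "\<And>g. g \<in> G \<Longrightarrow> P (monom g 1)"
    and add: "\<And>p q. P p \<Longrightarrow> P q \<Longrightarrow> P (p + q)"
    and mult: "\<And>p q. P p \<Longrightarrow> P q \<Longrightarrow> P (p * q)"
  shows "P p"
proof -
  have zero: "P 0"
    using const[of 0] closed_subringD(1)[OF A] by simp
  have degree_one: "P (monom x 1)" if "x \<in> genideal (ring_on A) G" for x
  proof -
    have "ideal {x \<in> A. P (monom x 1)} (ring_on A)"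
      unfolding ideal_ring_on_iff[OF A]
    proof safe
      fix b x assume "b \<in> A" "x \<in> A" "P (monom x 1)"
      then have "P ([:b:] * monom x 1)"
        by (intro mult const)
      then show "P (monom (b * x) 1)"
        by (simp add: smult_monom)
    qed (auto intro: closed_subringD[OF A] add simp: zero simp flip: add_monom)
    moreover have "G \<subseteq> {x \<in> A. P (monom x 1)}"
      using G gen by blast
    ultimately show ?thesis
      using genideal_subset_ideal that by blast
  qed
  have degree: "P (monom x k)" if "x \<in> ideal_power (ring_on A) (genideal (ring_on A) G) k" for x k
    using that
  proof (induction k arbitrary: x)
    case 0
    then show ?case
      using const[of x] by (simp add: monom_0)
  next
    case (Suc k)
    from Suc.prems have "x \<in> ideal_prod (ring_on A) (genideal (ring_on A) G) (ideal_power (ring_on A) (genideal (ring_on A) G) k)"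
      by simp
    then show ?case
    proof (induction rule: ideal_prod.induct)
      case (prod a b)
      from mult[OF degree_one[OF prod(1)] Suc.IH[OF prod(2)]] show ?case
        by (simp add: mult_monom)
    next
      case (sum s t)
      from add[OF sum(3,4)] show ?case
        by (simp add: add_monom)
    qed
  qed
  have "P (\<Sum>i\<in>J. monom (coeff p i) i)" for J
    by (induction J rule: infinite_finite_induct) (auto intro: add degree p zero)
  then show ?thesis
    using poly_as_sum_of_monoms[of p] by metis
qed

section \<open>An upper bound for the analytic spread\<close>

abbreviation rees_carrier :: "'a::comm_ring_1 set \<Rightarrow> 'a set \<Rightarrow> 'a poly set" where
  "rees_carrier A I \<equiv> {p. \<forall>k. coeff p k \<in> ideal_power (ring_on A) I k}"

lemma ideal_genideal:
  assumes "closed_subring A" "G \<subseteq> A"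
  shows "ideal (genideal (ring_on A) G) (ring_on A)"
  using ring.genideal_ideal[OF cring.axioms(1)[OF cring_ring_on[OF assms(1)]]] assms(2) by simp

lemma genideal_base: "G \<subseteq> genideal R G"
  unfolding genideal_def by blast

lemma constant_max_homogeneous_in_rees:
  fixes I :: "('a, 'b::comm_ring_1) mpoly set"
  assumes "ideal I (ring_on (mpolys_in Z))"
  shows "(\<lambda>a. [:a:]) ` max_homogeneous_ideal Z \<subseteq> rees_carrier (mpolys_in Z) I"
proof -
  have "mvar ` Z \<subseteq> (mpolys_in Z :: ('a, 'b) mpoly set)"
    using mvar_in_mpolys_in by (rule image_subsetI)
  from ideal_genideal[OF closed_subring_mpolys_in this]
  have "max_homogeneous_ideal Z \<subseteq> (mpolys_in Z :: ('a, 'b) mpoly set)"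
    unfolding max_homogeneous_ideal_def mpoly_ring_eq ideal_ring_on_iff[OF closed_subring_mpolys_in]
    by (rule conjunct1)
  then show ?thesis
    using constant_in_rees[OF closed_subring_mpolys_in assms] by (metis (no_types, lifting) image_subsetI subsetD)
qed

lemma scalar_embedding_constants:
  "scalar_embedding (\<lambda>c. [:mconst c:] :: ('x::linorder, 'k::field) mpoly poly)"
  by unfold_locales (simp_all add: mconst_simps one_pCons)

lemma analytic_spread_eq:
  assumes "ideal I (ring_on (mpolys_in Z))"
  shows "analytic_spread Z I = krull_dim (ring_on (rees_carrier (mpolys_in Z) I) Quot
    genideal (ring_on (rees_carrier (mpolys_in Z) I)) ((\<lambda>a. [:a:]) ` max_homogeneous_ideal Z))"
  unfolding analytic_spread_def special_fiber_def mpoly_ring_eq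
    rees_algebra_eq[OF closed_subring_mpolys_in assms] ..

text \<open>The elements of the Rees algebra that modulo \<open>\<mm> A[It]\<close> lie in the localization of \<open>K[U]\<close> at \<open>D\<close> form
  a subring. It contains the scalars, the variables (which are congruent to \<open>0\<close>) and, by hypothesis, the elements
  \<open>g t\<close>; so it is the whole Rees algebra.\<close>

theorem analytic_spread_le_card:
  fixes G :: "('x::linorder, 'k::field) mpoly set"
  defines "\<kappa> \<equiv> (\<lambda>c. [:mconst c:] :: ('x, 'k) mpoly poly)"
  assumes G: "G \<subseteq> mpolys_in Z"
    and U: "finite U" and D: "D \<noteq> 0" "D \<in> scalar_embedding.box_span \<kappa> U 1"
    and gen: "\<And>g. g \<in> G \<Longrightarrow> monom g 1 \<in> scalar_embedding.denominator_span \<kappa> U D"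
  shows "analytic_spread Z (genideal (mpoly_ring Z) G) \<le> enat (card U)"
proof -
  interpret scalar_embedding \<kappa>
    unfolding \<kappa>_def by (rule scalar_embedding_constants)
  let ?A = "mpolys_in Z :: ('x, 'k) mpoly set"
  note A = closed_subring_mpolys_in[of Z, where ?'b = 'k]
  define I where "I = genideal (ring_on ?A) G"
  have I: "ideal I (ring_on ?A)"
    unfolding I_def by (rule ideal_genideal[OF A G])
  define B where "B = rees_carrier ?A I"
  have B: "closed_subring B"
    unfolding B_def by (rule closed_subring_rees[OF A I])
  define J where "J = genideal (ring_on B) ((\<lambda>a. [:a:]) ` max_homogeneous_ideal Z)"
  have J: "ideal J (ring_on B)"
    unfolding J_def B_def
    by (rule ideal_genideal[OF B[unfolded B_def] constant_max_homogeneous_in_rees[OF I]])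
  note J_props = J[unfolded ideal_ring_on_iff[OF B]]
  have const_B: "[:a:] \<in> B" if "a \<in> ?A" for a
    unfolding B_def using constant_in_rees[OF A I that] .
  have var_J: "[:mvar z:] \<in> J" if "z \<in> Z" for z
    unfolding J_def max_homogeneous_ideal_def by (intro subsetD[OF genideal_base] imageI that)
  define T where "T = {b \<in> B. \<exists>l\<in>B \<inter> denominator_span U D. b - l \<in> J}"
  have T_I: "b \<in> T" if "b \<in> B" "b \<in> denominator_span U D" for b
    using that J_props unfolding T_def by (auto intro!: bexI[of _ b])
  have T_add: "p + q \<in> T" if pq: "p \<in> T" "q \<in> T" for p q
  proof -
    obtain l l' where l: "l \<in> B" "l \<in> denominator_span U D" "p - l \<in> J"
      "l' \<in> B" "l' \<in> denominator_span U D" "q - l' \<in> J"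
      using pq unfolding T_def by blast
    have "(p - l) + (q - l') \<in> J"
      using J_props l(3,6) by blast
    then have "(p + q) - (l + l') \<in> J"
      by (simp add: algebra_simps)
    then show ?thesis
      using pq l closed_subringD(4)[OF B] denominator_span_add[OF D(2) l(2,5)] unfolding T_def by blast
  qed
  have T_mult: "p * q \<in> T" if pq: "p \<in> T" "q \<in> T" for p q
  proof -
    obtain l l' where l: "l \<in> B" "l \<in> denominator_span U D" "p - l \<in> J"
      "l' \<in> B" "l' \<in> denominator_span U D" "q - l' \<in> J"
      using pq unfolding T_def by blast
    have "l' * (p - l) + p * (q - l') \<in> J"
      using J_props l pq unfolding T_def by blast
    then have "p * q - l * l' \<in> J"
      by (simp add: algebra_simps)
    then show ?thesis
      using pq l closed_subringD(6)[OF B] denominator_span_mult[OF l(2,5)] unfolding T_def by blast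
  qed
  have T_const: "[:a:] \<in> T" if "a \<in> ?A" for a
    using that
  proof (induction rule: mpolys_in_induct)
    case (const c)
    show ?case
      using kappa_in_denominator_span[of c U D] const_B[OF mconst_in_mpolys_in]
      by (intro T_I) (simp_all add: \<kappa>_def)
  next
    case (var z)
    have "0 \<in> denominator_span U D"
      using kappa_in_denominator_span[of 0 U D] by (simp add: kappa_zero)
    then show ?case
      using var_J[OF var] const_B[OF mvar_in_mpolys_in[OF var]] closed_subringD(1)[OF B]
      unfolding T_def by (auto intro!: bexI[of _ 0])
  next
    case (add p q)
    then show ?case
      using T_add by fastforce
  next
    case (mult p q)
    then show ?case
      using T_mult by fastforce
  qed
  have T_gen: "monom g 1 \<in> T" if "g \<in> G" for g
  proof -
    have "g \<in> I"
      unfolding I_def by (rule subsetD[OF genideal_base that])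
    then have "monom g 1 \<in> B"
      unfolding B_def by (intro monom_in_rees[OF A I] ideal_power_one[OF A I])
    then show ?thesis
      using gen[OF that] by (rule T_I)
  qed
  have "b \<in> T" if "b \<in> B" for b
  proof (rule rees_induct[OF A G, where P = "\<lambda>p. p \<in> T"])
    show "coeff b k \<in> ideal_power (ring_on ?A) (genideal (ring_on ?A) G) k" for k
      using that unfolding B_def I_def by blast
  qed (fact T_const T_gen T_add T_mult)+
  then have "\<exists>l\<in>B \<inter> denominator_span U D. b - l \<in> J" if "b \<in> B" for b
    using that unfolding T_def by blast
  moreover have "range \<kappa> \<subseteq> B"
    using const_B mconst_in_mpolys_in unfolding \<kappa>_def by blast
  ultimately have "krull_dim (ring_on B Quot J) \<le> enat (card U)"
    by (intro krull_dim_Quot_le_card[OF B _ J U D])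
  then show ?thesis
    unfolding mpoly_ring_eq using analytic_spread_eq[OF I] by (simp add: I_def B_def J_def)
qed

section \<open>Homogeneous components and evaluation at zero\<close>

definition total_degree :: "('x \<Rightarrow>\<^sub>0 nat) \<Rightarrow> nat" where
  "total_degree m = sum (Poly_Mapping.lookup m) (Poly_Mapping.keys m)"

lemma total_degree_add: "total_degree (m + m') = total_degree m + total_degree m'"
proof -
  have ext: "total_degree a = sum (Poly_Mapping.lookup a) (Poly_Mapping.keys m \<union> Poly_Mapping.keys m')"
    if "Poly_Mapping.keys a \<subseteq> Poly_Mapping.keys m \<union> Poly_Mapping.keys m'" for a
    unfolding total_degree_def
    by (rule sum.mono_neutral_left) (use that in \<open>auto simp: in_keys_iff\<close>)
  show ?thesis
    by (simp add: ext keys_add_nat lookup_add sum.distrib)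
qed

text \<open>The homomorphism \<open>graded Z\<close> defined from these terms sends a variable \<open>z \<in> Z\<close> to \<open>z s\<close> and all other
  variables to \<open>0\<close>. So the coefficient of \<open>s\<^sup>j\<close> in \<open>graded Z p\<close> is the homogeneous component of degree \<open>j\<close>
  of \<open>p\<close> with the variables outside \<open>Z\<close> set to zero.\<close>

definition graded_term :: "'x set \<Rightarrow> ('x \<Rightarrow>\<^sub>0 nat) \<Rightarrow> 'k::comm_ring_1 \<Rightarrow> ('x, 'k) mpoly poly" where
  "graded_term Z m a =
     (if Poly_Mapping.keys m \<subseteq> Z then monom (Poly_Mapping.single m a) (total_degree m) else 0)"

definition graded :: "'x set \<Rightarrow> ('x, 'k::comm_ring_1) mpoly \<Rightarrow> ('x, 'k) mpoly poly" where
  "graded Z p = (\<Sum>m\<in>Poly_Mapping.keys p. graded_term Z m (Poly_Mapping.lookup p m))"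

lemma graded_term_zero [simp]: "graded_term Z m 0 = 0"
  by (simp add: graded_term_def)

lemma graded_term_add: "graded_term Z m (a + b) = graded_term Z m a + graded_term Z m b"
  by (simp add: graded_term_def single_add add_monom)

lemma graded_term_mult:
  "graded_term Z (m + m') (a * b) = graded_term Z m a * graded_term Z m' b"
  by (simp add: graded_term_def keys_add_nat total_degree_add mult_monom mult_single)

lemma graded_single: "graded Z (Poly_Mapping.single m a) = graded_term Z m a"
  by (simp add: graded_def)

lemma graded_eq_sum:
  assumes "finite M" "Poly_Mapping.keys p \<subseteq> M"
  shows "graded Z p = (\<Sum>m\<in>M. graded_term Z m (Poly_Mapping.lookup p m))"
  unfolding graded_def
  by (rule sum.mono_neutral_left) (use assms in \<open>auto simp: in_keys_iff\<close>)

lemma graded_add: "graded Z (p + q) = graded Z p + graded Z q"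
proof -
  let ?M = "Poly_Mapping.keys p \<union> Poly_Mapping.keys q"
  have ext: "graded Z r = (\<Sum>m\<in>?M. graded_term Z m (Poly_Mapping.lookup r m))"
    if "Poly_Mapping.keys r \<subseteq> ?M" for r
    by (rule graded_eq_sum) (use that in auto)
  show ?thesis
    using ext[of "p + q"] ext[of p] ext[of q] Poly_Mapping.keys_add[of p q]
    by (simp add: lookup_add graded_term_add sum.distrib)
qed

lemma graded_zero [simp]: "graded Z 0 = 0"
  by (simp add: graded_def)

lemma graded_sum: "graded Z (\<Sum>i\<in>I. f i) = (\<Sum>i\<in>I. graded Z (f i))"
  by (induction I rule: infinite_finite_induct) (simp_all add: graded_add)

lemma graded_mult: "graded Z (p * q) = graded Z p * graded Z q"
proof -
  have "p * q = (\<Sum>m\<in>Poly_Mapping.keys p. \<Sum>m'\<in>Poly_Mapping.keys q.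
      Poly_Mapping.single (m + m') (Poly_Mapping.lookup p m * Poly_Mapping.lookup q m'))"
    by (subst poly_mapping_sum_single[of p], subst poly_mapping_sum_single[of q])
      (simp add: sum_product mult_single)
  then show ?thesis
    by (simp add: graded_sum graded_single graded_term_mult sum_product) (simp add: graded_def sum_product)
qed

lemma graded_mconst: "graded Z (mconst c) = [:mconst c:]"
  by (simp add: mconst_def graded_single graded_term_def total_degree_def monom_0)

lemma graded_one: "graded Z 1 = 1"
  using graded_mconst[of Z 1] by (simp add: mconst_simps one_pCons)

lemma graded_uminus: "graded Z (- p) = - graded Z p"
  using graded_add[of Z p "- p"] by (simp add: eq_neg_iff_add_eq_0 add.commute)

lemma graded_diff: "graded Z (p - q) = graded Z p - graded Z q"
  using graded_add[of Z p "- q"] by (simp add: graded_uminus)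

lemma graded_mvar: "graded Z (mvar z) = (if z \<in> Z then monom (mvar z) 1 else 0)"
  by (simp add: mvar_def graded_single graded_term_def total_degree_def)

lemma coeff_graded_mono:
  assumes "coeff (graded Z p) k = 0" "Y \<subseteq> Z"
  shows "coeff (graded Y p) k = 0"
proof -
  have lookup: "Poly_Mapping.lookup (coeff (graded Z p) k) m =
      (if Poly_Mapping.keys m \<subseteq> Z \<and> total_degree m = k then Poly_Mapping.lookup p m else 0)"
    for m and Z :: "'a set"
  proof -
    have "Poly_Mapping.lookup (coeff (graded Z p) k) m =
        (\<Sum>m'\<in>Poly_Mapping.keys p. if m' = m then
           (if Poly_Mapping.keys m \<subseteq> Z \<and> total_degree m = k then Poly_Mapping.lookup p m else 0) else 0)"
      unfolding graded_def coeff_sum lookup_sum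
      by (intro sum.cong) (auto simp: graded_term_def lookup_single when_def)
    then show ?thesis
      by (simp add: in_keys_iff)
  qed
  show ?thesis
  proof (rule poly_mapping_eqI)
    fix m
    show "Poly_Mapping.lookup (coeff (graded Y p) k) m = Poly_Mapping.lookup 0 m"
      using lookup[of Z m] lookup[of Y m] assms by (auto split: if_splits)
  qed
qed

section \<open>A lower bound for the analytic spread\<close>

text \<open>Lowest terms multiply; this makes the passage to lowest components a ring homomorphism.\<close>

lemma coeff_mult_of_low_order:
  fixes p q :: "'a::comm_ring_1 poly"
  assumes p: "\<And>i. i < a \<Longrightarrow> coeff p i = 0" and q: "\<And>i. i < b \<Longrightarrow> coeff q i = 0"
  shows "j < a + b \<Longrightarrow> coeff (p * q) j = 0"
    and "coeff (p * q) (a + b) = coeff p a * coeff q b"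
proof -
  show "coeff (p * q) j = 0" if "j < a + b"
    unfolding coeff_mult
  proof (intro sum.neutral ballI)
    fix i assume "i \<in> {..j}"
    then have "i < a \<or> j - i < b"
      using that by auto
    then show "coeff p i * coeff q (j - i) = 0"
      using p q by auto
  qed
  have "coeff (p * q) (a + b) = (\<Sum>i\<le>a + b. if i = a then coeff p a * coeff q b else 0)"
    unfolding coeff_mult
  proof (intro sum.cong refl)
    fix i assume "i \<in> {..a + b}"
    then consider "i < a" | "i = a" | "a + b - i < b"
      by fastforce
    then show "coeff p i * coeff q (a + b - i) = (if i = a then coeff p a * coeff q b else 0)"
      using p q by cases auto
  qed
  then show "coeff (p * q) (a + b) = coeff p a * coeff q b"
    by simp
qed

text \<open>Orders of vanishing add up in products, so this passes from the generators to the ideal and from there to its powers.\<close>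

lemma ideal_power_low_order:
  fixes G :: "('x, 'k::field) mpoly set"
  assumes G: "G \<subseteq> mpolys_in Z"
    and low: "\<And>g j. g \<in> G \<Longrightarrow> j < \<delta> \<Longrightarrow> coeff (graded W g) j = 0"
    and f: "f \<in> ideal_power (ring_on (mpolys_in Z)) (genideal (ring_on (mpolys_in Z)) G) k"
    and j: "j < \<delta> * k"
  shows "coeff (graded W f) j = 0"
  using f j
proof (induction k arbitrary: f j)
  case (Suc k)
  let ?A = "mpolys_in Z :: ('x, 'k) mpoly set"
  have base: "coeff (graded W f) j = 0" if f: "f \<in> genideal (ring_on ?A) G" and "j < \<delta>" for f j
  proof -
    have "ideal {f \<in> ?A. \<forall>j<\<delta>. coeff (graded W f) j = 0} (ring_on ?A)"
      unfolding ideal_ring_on_iff[OF closed_subring_mpolys_in]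
      using coeff_mult_of_low_order(1)[where a = 0 and b = \<delta>]
      by (auto simp: graded_add graded_mult closed_subringD[OF closed_subring_mpolys_in])
    moreover have "G \<subseteq> {f \<in> ?A. \<forall>j<\<delta>. coeff (graded W f) j = 0}"
      using G low by blast
    ultimately show ?thesis
      using genideal_subset_ideal that by blast
  qed
  from Suc.prems(1) have "f \<in> ideal_prod (ring_on ?A) (genideal (ring_on ?A) G)
      (ideal_power (ring_on ?A) (genideal (ring_on ?A) G) k)"
    by simp
  then show ?case
    using Suc.prems(2)
  proof (induction rule: ideal_prod.induct)
    case (prod a b)
    then show ?case
      using coeff_mult_of_low_order(1)[OF base[OF prod(1)] Suc.IH[OF prod(2)]]
      by (simp add: graded_mult)
  qed (simp add: graded_add)
qed simp

text \<open>The homomorphism from the Rees algebra to \<open>S[t]\<close> whose kernels form the chain for the lower bound. If the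
  generators of the ideal have no terms of degree below \<open>\<delta>\<close>, then the coefficient of \<open>t\<^sup>k\<close> has none below \<open>\<delta> k\<close>,
  and its component of degree \<open>\<delta> k\<close> is kept, with the variables outside \<open>W\<close> set to zero.\<close>

definition lowest_part :: "nat \<Rightarrow> 'x set \<Rightarrow> ('x, 'k::comm_ring_1) mpoly poly \<Rightarrow> ('x, 'k) mpoly poly" where
  "lowest_part \<delta> W p = Abs_poly (\<lambda>k. coeff (graded W (coeff p k)) (\<delta> * k))"

lemma coeff_lowest_part: "coeff (lowest_part \<delta> W p) k = coeff (graded W (coeff p k)) (\<delta> * k)"
  unfolding lowest_part_def
  by (subst coeff_Abs_poly[of "degree p"]) (simp_all add: coeff_eq_0)

text \<open>The kernels of \<open>lowest_part \<delta> (W i)\<close> are primes since \<open>S[t]\<close> is a domain. They contain the constants from \<open>\<mm>\<close>, since an element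
  of \<open>\<mm>\<close> has no component of degree \<open>0\<close>, and they increase, since more and more variables are set to zero. The element \<open>g t\<close>
  with \<open>g\<close> from the last hypothesis shows that they increase strictly.\<close>

theorem analytic_spread_ge:
  fixes G :: "('x::linorder, 'k::field) mpoly set"
  assumes G: "G \<subseteq> mpolys_in Z"
    and low: "\<And>g j. g \<in> G \<Longrightarrow> j < \<delta> \<Longrightarrow> coeff (graded UNIV g) j = 0"
    and dec: "\<And>i. i < d \<Longrightarrow> W (Suc i) \<subseteq> W i"
    and sep: "\<And>i. i < d \<Longrightarrow>
      \<exists>g\<in>G. coeff (graded (W i) g) \<delta> \<noteq> 0 \<and> coeff (graded (W (Suc i)) g) \<delta> = 0"
  shows "enat d \<le> analytic_spread Z (genideal (mpoly_ring Z) G)"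
proof -
  let ?A = "mpolys_in Z :: ('x, 'k) mpoly set"
  note A = closed_subring_mpolys_in[of Z, where ?'b = 'k]
  define I where "I = genideal (ring_on ?A) G"
  have I: "ideal I (ring_on ?A)"
    unfolding I_def by (rule ideal_genideal[OF A G])
  define B where "B = rees_carrier ?A I"
  have B: "closed_subring B"
    unfolding B_def by (rule closed_subring_rees[OF A I])
  define J where "J = genideal (ring_on B) ((\<lambda>a. [:a:]) ` max_homogeneous_ideal Z)"
  have sub_B: "(\<lambda>a. [:a:]) ` max_homogeneous_ideal Z \<subseteq> B"
    unfolding B_def by (rule constant_max_homogeneous_in_rees[OF I])
  have J: "ideal J (ring_on B)"
    unfolding J_def by (rule ideal_genideal[OF B sub_B])
  have low_B: "coeff (graded V (coeff p k)) j = 0" if "p \<in> B" "j < \<delta> * k" for V p k j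
    using ideal_power_low_order[OF G coeff_graded_mono[OF low subset_UNIV]] that unfolding B_def I_def by blast
  define Q where "Q i = {p \<in> B. lowest_part \<delta> (W i) p = 0}" for i
  have prime: "primeideal (Q i) (ring_on B)" for i
    unfolding Q_def
  proof (rule primeideal_kernel[OF B])
    show "lowest_part \<delta> (W i) 1 = 1"
      by (intro poly_eqI) (simp add: coeff_lowest_part graded_one)
    fix p q assume pq: "p \<in> B" "q \<in> B"
    show "lowest_part \<delta> (W i) (p + q) = lowest_part \<delta> (W i) p + lowest_part \<delta> (W i) q"
      by (intro poly_eqI) (simp add: coeff_lowest_part graded_add)
    have "coeff (graded (W i) (coeff p a) * graded (W i) (coeff q (k - a))) (\<delta> * k) =
        coeff (graded (W i) (coeff p a)) (\<delta> * a) * coeff (graded (W i) (coeff q (k - a))) (\<delta> * (k - a))"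
      if "a \<le> k" for a k
    proof -
      have "\<delta> * k = \<delta> * a + \<delta> * (k - a)"
        using that by (simp flip: add_mult_distrib2)
      then show ?thesis
        using coeff_mult_of_low_order(2)[OF low_B[OF pq(1), of _ a "W i"] low_B[OF pq(2), of _ "k - a" "W i"]]
        by simp
    qed
    then show "lowest_part \<delta> (W i) (p * q) = lowest_part \<delta> (W i) p * lowest_part \<delta> (W i) q"
      by (intro poly_eqI) (simp add: coeff_lowest_part coeff_mult[of p q] coeff_mult[of "lowest_part _ _ _"]
          graded_sum graded_mult coeff_sum)
  qed
  have "J \<subseteq> Q i" for i
    unfolding J_def
  proof (rule genideal_subset_ideal[OF primeideal.axioms(1)[OF prime]], rule image_subsetI)
    fix a :: "('x, 'k) mpoly" assume a: "a \<in> max_homogeneous_ideal Z"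
    have "ideal {f \<in> ?A. coeff (graded (W i) f) 0 = 0} (ring_on ?A)"
      unfolding ideal_ring_on_iff[OF A]
      by (auto simp: graded_add graded_mult coeff_mult_0 closed_subringD[OF A])
    moreover have "mvar ` Z \<subseteq> {f \<in> ?A. coeff (graded (W i) f) 0 = 0}"
      using mvar_in_mpolys_in by (auto simp: graded_mvar)
    ultimately have "coeff (graded (W i) a) 0 = 0"
      using a genideal_subset_ideal unfolding max_homogeneous_ideal_def mpoly_ring_eq by blast
    then have "lowest_part \<delta> (W i) [:a:] = 0"
      by (intro poly_eqI) (simp add: coeff_lowest_part coeff_pCons split: nat.split)
    then show "[:a:] \<in> Q i"
      using sub_B a unfolding Q_def by blast
  qed
  moreover have "Q i \<subset> Q (Suc i)" if "i < d" for i
  proof -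
    have "Q i \<subseteq> Q (Suc i)"
      unfolding Q_def by (auto simp: poly_eq_iff coeff_lowest_part intro: coeff_graded_mono[OF _ dec[OF that]])
    moreover obtain g where g: "g \<in> G" "coeff (graded (W i) g) \<delta> \<noteq> 0" "coeff (graded (W (Suc i)) g) \<delta> = 0"
      using sep[OF \<open>i < d\<close>] by blast
    have "g \<in> I"
      unfolding I_def by (rule subsetD[OF genideal_base g(1)])
    then have "monom g 1 \<in> B"
      unfolding B_def by (intro monom_in_rees[OF A I] ideal_power_one[OF A I])
    moreover have "lowest_part \<delta> V (monom g 1) = monom (coeff (graded V g) \<delta>) 1" for V
      by (intro poly_eqI) (auto simp: coeff_lowest_part)
    ultimately show ?thesis
      unfolding Q_def using g(2,3) by fastforce
  qed
  ultimately have "enat d \<le> krull_dim (ring_on B Quot J)"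
    using prime by (intro krull_dim_Quot_ge[OF cring_ring_on[OF B] J, of d Q]) auto
  then show ?thesis
    unfolding mpoly_ring_eq using analytic_spread_eq[OF I] by (simp add: I_def B_def J_def)
qed

section \<open>Growing a connected graph vertex by vertex\<close>

lemma connected_graph_crossing_edge:
  assumes "connected_graph V E" "C \<subset> V" "C \<noteq> {}"
  shows "\<exists>u v. {u, v} \<in> E \<and> u \<in> C \<and> v \<in> V - C"
proof (rule ccontr)
  assume no_edge: "\<not> ?thesis"
  obtain u w where uw: "u \<in> C" "w \<in> V - C"
    using assms(2,3) by blast
  have "(u, w) \<in> {(i, j). {i, j} \<in> E}\<^sup>*"
    using assms(1,2) uw unfolding connected_graph_def by blast
  then have "w \<in> C"
  proof (induction rule: rtrancl_induct)
    case (step y z)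
    then have "{y, z} \<in> E" by simp
    moreover from this have "z \<in> V"
      using assms(1) unfolding connected_graph_def simple_graph_def by blast
    ultimately show ?case
      using no_edge step.IH by blast
  qed (rule uw)
  then show False
    using uw by blast
qed

text \<open>The vertex sets of a growing connected subgraph: each new vertex is adjacent to an earlier one.\<close>

lemma connected_graph_growing_sets:
  assumes "connected_graph V E" "k < card V"
  shows "\<exists>D. (\<forall>i\<le>k. D i \<subseteq> V \<and> card (D i) = Suc i) \<and>
    (\<forall>i<k. D i \<subseteq> D (Suc i) \<and> (\<exists>u v. {u, v} \<in> E \<and> u \<in> D i \<and> v \<in> D (Suc i) - D i))"
  using assms(2)
proof (induction k)
  case 0
  obtain v where "v \<in> V"
    using assms(1) unfolding connected_graph_def by blast
  then show ?case
    by (intro exI[of _ "\<lambda>_. {v}"]) auto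
next
  case (Suc k)
  have fin: "finite V"
    using assms(1) unfolding connected_graph_def simple_graph_def by blast
  obtain D where D: "\<forall>i\<le>k. D i \<subseteq> V \<and> card (D i) = Suc i"
    "\<forall>i<k. D i \<subseteq> D (Suc i) \<and> (\<exists>u v. {u, v} \<in> E \<and> u \<in> D i \<and> v \<in> D (Suc i) - D i)"
    using Suc by auto
  have Dk: "D k \<subseteq> V" "card (D k) = Suc k"
    using D(1) by auto
  then have "D k \<noteq> V" "D k \<noteq> {}"
    using Suc.prems by auto
  then obtain u v where uv: "{u, v} \<in> E" "u \<in> D k" "v \<in> V - D k"
    using connected_graph_crossing_edge[OF assms(1), of "D k"] Dk(1) by blast
  define D' where "D' = D(Suc k := insert v (D k))"
  have "finite (D k)"
    using Dk(1) fin finite_subset by blast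
  then have "D' i \<subseteq> V \<and> card (D' i) = Suc i" if "i \<le> Suc k" for i
    using that D(1) Dk uv(3) by (auto simp: D'_def le_Suc_eq)
  moreover have "D' i \<subseteq> D' (Suc i) \<and> (\<exists>u v. {u, v} \<in> E \<and> u \<in> D' i \<and> v \<in> D' (Suc i) - D' i)"
    if "i < Suc k" for i
  proof (cases "i = k")
    case True
    then show ?thesis
      using uv by (auto simp: D'_def)
  next
    case False
    then have "i < k" using that by simp
    then show ?thesis
      using D(2)[rule_format, of i] by (simp add: D'_def)
  qed
  ultimately show ?case by blast
qed

section \<open>Edge binomials and the Pluecker relation\<close>

text \<open>A linear order on the variables makes the polynomial ring an integral domain, by comparing leading monomials.
  Any linear order would do; this one is pulled back from an injection into the natural numbers.\<close>

instantiation edge_var :: linorder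
begin

primrec edge_var_code :: "edge_var \<Rightarrow> nat" where
  "edge_var_code (Xv i) = 2 * i"
| "edge_var_code (Yv i) = 2 * i + 1"

definition less_eq_edge_var :: "edge_var \<Rightarrow> edge_var \<Rightarrow> bool" where
  "v \<le> w \<longleftrightarrow> edge_var_code v \<le> edge_var_code w"

definition less_edge_var :: "edge_var \<Rightarrow> edge_var \<Rightarrow> bool" where
  "v < w \<longleftrightarrow> edge_var_code v < edge_var_code w"

instance
proof
  fix v w :: edge_var
  assume "v \<le> w" "w \<le> v"
  then have "edge_var_code v = edge_var_code w"
    by (simp add: less_eq_edge_var_def)
  then show "v = w"
    by (cases v; cases w; simp; presburger)
qed (auto simp: less_eq_edge_var_def less_edge_var_def)

end

definition edge_binomial :: "nat \<Rightarrow> nat \<Rightarrow> (edge_var, 'k::comm_ring_1) mpoly" where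
  "edge_binomial i j = mvar (Xv i) * mvar (Yv j) - mvar (Xv j) * mvar (Yv i)"

definition edge_binomials :: "nat set set \<Rightarrow> (edge_var, 'k::comm_ring_1) mpoly set" where
  "edge_binomials E = {edge_binomial i j | i j. {i, j} \<in> E}"

lemma binomial_edge_ideal_eq:
  "binomial_edge_ideal n E = genideal (mpoly_ring (edge_vars n)) (edge_binomials E)"
  by (simp add: binomial_edge_ideal_def edge_binomials_def edge_binomial_def)

lemma edge_binomial_nonzero:
  assumes "i \<noteq> j"
  shows "(edge_binomial i j :: (edge_var, 'k::comm_ring_1) mpoly) \<noteq> 0"
proof -
  let ?m = "\<lambda>i j. Poly_Mapping.single (Xv i) 1 + Poly_Mapping.single (Yv j) (1::nat)"
  have "Poly_Mapping.lookup (?m j i) (Xv i) \<noteq> Poly_Mapping.lookup (?m i j) (Xv i)"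
    using assms by (simp add: lookup_add lookup_single)
  then have "?m j i \<noteq> ?m i j"
    by metis
  then have "Poly_Mapping.lookup (edge_binomial i j :: (edge_var, 'k) mpoly) (?m i j) = 1"
    by (simp add: edge_binomial_def mvar_def mult_single lookup_minus lookup_single)
  then show ?thesis
    by (metis lookup_zero zero_neq_one)
qed

lemma edge_binomials_subset:
  assumes "simple_graph {1..n} E"
  shows "(edge_binomials E :: (edge_var, 'k::comm_ring_1) mpoly set) \<subseteq> mpolys_in (edge_vars n)"
proof
  fix g :: "(edge_var, 'k) mpoly" assume "g \<in> edge_binomials E"
  then obtain i j where g: "g = edge_binomial i j" and "{i, j} \<in> E"
    unfolding edge_binomials_def by blast
  then have "i \<in> {1..n}" "j \<in> {1..n}"
    using assms unfolding simple_graph_def by blast+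
  then show "g \<in> mpolys_in (edge_vars n)"
    unfolding g edge_binomial_def
    by (intro closed_subringD[OF closed_subring_mpolys_in] mvar_in_mpolys_in) (auto simp: edge_vars_def)
qed

definition vertex_vars :: "nat set \<Rightarrow> edge_var set" where
  "vertex_vars C = Xv ` C \<union> Yv ` C"

lemma graded_edge_binomial:
  "graded (vertex_vars C) (edge_binomial i j) =
     (if i \<in> C \<and> j \<in> C then monom (edge_binomial i j) 2 else 0)"
proof -
  have "Xv v \<in> vertex_vars C \<longleftrightarrow> v \<in> C" "Yv v \<in> vertex_vars C \<longleftrightarrow> v \<in> C" for v
    by (auto simp: vertex_vars_def)
  then show ?thesis
    by (auto simp: edge_binomial_def graded_diff graded_mult graded_mvar mult_monom diff_monom
        numeral_2_eq_2)
qed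

lemma plucker_relation:
  "edge_binomial a b * edge_binomial i j =
     edge_binomial a i * edge_binomial b j - edge_binomial a j * edge_binomial b i"
  by (simp add: edge_binomial_def algebra_simps)

lemma edge_binomial_swap: "edge_binomial j i = - edge_binomial i j"
  by (simp add: edge_binomial_def)

text \<open>As \<open>[2 1] = - [1 2]\<close>, the second family can start at \<open>j = 3\<close>,
  which leaves \<open>(n - 1) + (n - 2) = 2n - 3\<close> elements.\<close>

definition plucker_generators :: "nat \<Rightarrow> (edge_var, 'k::field) mpoly poly set" where
  "plucker_generators n =
     (\<lambda>j. monom (edge_binomial 1 j) 1) ` {2..n} \<union> (\<lambda>j. monom (edge_binomial 2 j) 1) ` {3..n}"

lemma finite_plucker_generators: "finite (plucker_generators n)"
  by (simp add: plucker_generators_def)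

lemma card_plucker_generators_le:
  assumes "n \<ge> 2"
  shows "card (plucker_generators n) \<le> 2 * n - 3"
proof -
  have "card (plucker_generators n) \<le> card {2..n} + card {3..n}"
    unfolding plucker_generators_def
    by (rule order.trans[OF card_Un_le add_mono[OF card_image_le card_image_le]]) auto
  also have "card {2..n} + card {3..n} = 2 * n - 3"
    using assms by simp
  finally show ?thesis .
qed

text \<open>By the Pluecker relation with \<open>a = 1\<close> and \<open>b = 2\<close>, multiplication by \<open>[1 2] t\<close> turns every \<open>[i j] t\<close> into a polynomial in
  the chosen generators.\<close>

lemma edge_binomials_in_denominator_span:
  defines "\<kappa> \<equiv> (\<lambda>c. [:mconst c:] :: (edge_var, 'k::field) mpoly poly)"
  defines "D \<equiv> monom (edge_binomial 1 2) 1 :: (edge_var, 'k) mpoly poly"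
  assumes n: "n \<ge> 2"
  shows "D \<in> scalar_embedding.box_span \<kappa> (plucker_generators n) 1"
    and "i \<in> {1..n} \<Longrightarrow> j \<in> {1..n} \<Longrightarrow>
      monom (edge_binomial i j) 1 \<in> scalar_embedding.denominator_span \<kappa> (plucker_generators n) D"
proof -
  interpret scalar_embedding \<kappa>
    unfolding \<kappa>_def by (rule scalar_embedding_constants)
  let ?U = "plucker_generators n :: (edge_var, 'k) mpoly poly set"
  let ?m = "\<lambda>i j. monom (edge_binomial i j) 1 :: (edge_var, 'k) mpoly poly"
  have U: "u \<in> box_span ?U 1" if "u \<in> ?U" for u
    by (rule generator_in_box_span[OF finite_plucker_generators that])
  have zero: "0 \<in> box_span ?U 1"
    using kappa_in_box_span[of 0] by (simp add: kappa_zero)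
  have row1: "?m 1 j \<in> box_span ?U 1" if "j \<in> {1..n}" for j
  proof (cases "j = 1")
    case True
    then show ?thesis
      using zero by (simp add: edge_binomial_def)
  next
    case False
    then show ?thesis
      using that by (intro U) (auto simp: plucker_generators_def)
  qed
  show D: "D \<in> box_span ?U 1"
    unfolding D_def using row1[of 2] n by simp
  have row2: "?m 2 j \<in> box_span ?U 1" if j: "j \<in> {1..n}" for j
  proof -
    consider "j = 1" | "j = 2" | "j \<in> {3..n}"
      using j by fastforce
    then show ?thesis
    proof cases
      case 1
      then show ?thesis
        using box_span_diff[OF zero D] edge_binomial_swap[of 2 1, where ?'a = 'k]
        by (simp add: D_def minus_monom)
    next
      case 2
      then show ?thesis
        using zero by (simp add: edge_binomial_def)
    next
      case 3
      then show ?thesis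
        by (intro U) (auto simp: plucker_generators_def)
    qed
  qed
  show "?m i j \<in> denominator_span ?U D" if "i \<in> {1..n}" "j \<in> {1..n}"
  proof (rule denominator_spanI[of D 1])
    have "D * ?m i j = ?m 1 i * ?m 2 j - ?m 1 j * ?m 2 i"
      unfolding D_def mult_monom diff_monom by (simp only: plucker_relation[of 1 2 i j])
    then show "D ^ 1 * ?m i j \<in> box_span ?U (1 + 1)"
      using box_span_diff[OF box_span_mult[OF row1 row2] box_span_mult[OF row1 row2]] that by simp
  qed
qed

section \<open>Analytic spread of binomial edge ideals\<close>

lemma analytic_spread_binomial_edge_ideal_le:
  assumes "n \<ge> 2" and E: "simple_graph {1..n} E"
  shows "analytic_spread (edge_vars n) (binomial_edge_ideal n E :: (edge_var, 'k::field) mpoly set)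
    \<le> enat (2 * n - 3)"
proof -
  let ?U = "plucker_generators n :: (edge_var, 'k) mpoly poly set"
  have "analytic_spread (edge_vars n) (binomial_edge_ideal n E :: (edge_var, 'k) mpoly set)
      \<le> enat (card ?U)"
    unfolding binomial_edge_ideal_eq
  proof (rule analytic_spread_le_card[OF edge_binomials_subset[OF E] finite_plucker_generators])
    show "(monom (edge_binomial 1 2) 1 :: (edge_var, 'k) mpoly poly) \<noteq> 0"
      by (simp add: edge_binomial_nonzero)
    fix g :: "(edge_var, 'k) mpoly"
    assume "g \<in> edge_binomials E"
    then obtain i j where g: "g = edge_binomial i j" and "{i, j} \<in> E"
      unfolding edge_binomials_def by blast
    then have "i \<in> {1..n}" "j \<in> {1..n}"
      using E unfolding simple_graph_def by blast+
    then show "monom g 1 \<in> scalar_embedding.denominator_span (\<lambda>c. [:mconst c:]) ?U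
        (monom (edge_binomial 1 2) 1)"
      unfolding g by (rule edge_binomials_in_denominator_span(2)[OF assms(1)])
  qed (rule edge_binomials_in_denominator_span(1)[OF assms(1)])
  also have "enat (card ?U) \<le> enat (2 * n - 3)"
    using card_plucker_generators_le[OF assms(1)] by simp
  finally show ?thesis .
qed

text \<open>The chain begins with the set of all vertices and removes them in the reverse of the order
  in which a connected subgraph grows. The edge that joins the removed vertex to an
  earlier one has its binomial killed at precisely this step.\<close>

lemma analytic_spread_binomial_edge_ideal_ge:
  assumes "n \<ge> 1" and E: "connected_graph {1..n} E"
  shows "enat (n - 1)
    \<le> analytic_spread (edge_vars n) (binomial_edge_ideal n E :: (edge_var, 'k::field) mpoly set)"
proof -
  have simple: "simple_graph {1..n} E"
    using E unfolding connected_graph_def by (rule conjunct1)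
  have "n - 1 < card {1..n}"
    using assms(1) by simp
  from connected_graph_growing_sets[OF E this] obtain D where
    D: "\<forall>i<n - 1. D i \<subseteq> D (Suc i) \<and> (\<exists>u v. {u, v} \<in> E \<and> u \<in> D i \<and> v \<in> D (Suc i) - D i)"
    by (elim exE conjE)
  define W where "W i = vertex_vars (D (n - 1 - i))" for i
  show ?thesis
    unfolding binomial_edge_ideal_eq
  proof (rule analytic_spread_ge[OF edge_binomials_subset[OF simple], of 2 _ W])
    fix g :: "(edge_var, 'k) mpoly" and j :: nat
    assume "g \<in> edge_binomials E" and j: "j < 2"
    then obtain u v where g: "g = edge_binomial u v"
      unfolding edge_binomials_def by blast
    have "v \<in> vertex_vars UNIV" for v
      by (cases v) (auto simp: vertex_vars_def)
    then have univ: "vertex_vars UNIV = UNIV"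
      by blast
    show "coeff (graded UNIV g) j = 0"
      using graded_edge_binomial[of UNIV u v, where ?'a = 'k] j unfolding g univ by simp
  next
    fix i assume i: "i < n - 1"
    define k where "k = n - 1 - Suc i"
    have k: "k < n - 1" "n - 1 - i = Suc k"
      using i by (auto simp: k_def)
    have W: "W i = vertex_vars (D (Suc k))" "W (Suc i) = vertex_vars (D k)"
      by (simp_all only: W_def k(2) k_def)
    note step = D[THEN spec, THEN mp, OF k(1)]
    have sub: "D k \<subseteq> D (Suc k)"
      using step by (rule conjunct1)
    have "\<exists>u v. {u, v} \<in> E \<and> u \<in> D k \<and> v \<in> D (Suc k) - D k"
      using step by (rule conjunct2)
    then obtain u v where uv: "{u, v} \<in> E" "u \<in> D k" "v \<in> D (Suc k)" "v \<notin> D k"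
      by blast
    show "W (Suc i) \<subseteq> W i"
      using sub unfolding W vertex_vars_def by (intro Un_mono image_mono)
    let ?g = "edge_binomial u v :: (edge_var, 'k) mpoly"
    have "?g \<noteq> 0"
      using uv(2,4) by (intro edge_binomial_nonzero) (rule notI, simp)
    then have "coeff (graded (W i) ?g) 2 \<noteq> 0" "coeff (graded (W (Suc i)) ?g) 2 = 0"
      using uv(2-4) subsetD[OF sub] by (simp_all add: W graded_edge_binomial)
    moreover have "?g \<in> edge_binomials E"
      unfolding edge_binomials_def using uv(1) by blast
    ultimately show "\<exists>g\<in>edge_binomials E. coeff (graded (W i) (g :: (edge_var, 'k) mpoly)) 2 \<noteq> 0 \<and>
        coeff (graded (W (Suc i)) g) 2 = 0"
      by blast
  qed
qed

theorem theorem1p1: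
  fixes n :: nat and E :: "nat set set"
  assumes "infinite (UNIV :: 'k::field set)"
    and "n \<ge> 2"
    and "connected_graph {1..n} E"
  shows "enat (n - 1)
           \<le> analytic_spread (edge_vars n) (binomial_edge_ideal n E :: (edge_var, 'k) mpoly set)
       \<and> analytic_spread (edge_vars n) (binomial_edge_ideal n E :: (edge_var, 'k) mpoly set)
           \<le> enat (2 * n - 3)"
proof
  show "enat (n - 1)
      \<le> analytic_spread (edge_vars n) (binomial_edge_ideal n E :: (edge_var, 'k) mpoly set)"
    using assms(2,3) by (intro analytic_spread_binomial_edge_ideal_ge) auto
  have "simple_graph {1..n} E"
    using assms(3) unfolding connected_graph_def by (rule conjunct1)
  with assms(2) show "analytic_spread (edge_vars n)
      (binomial_edge_ideal n E :: (edge_var, 'k) mpoly set) \<le> enat (2 * n - 3)"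
    by (rule analytic_spread_binomial_edge_ideal_le)
qed

end
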